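(* Let $\lambda/\mu$ be a skew partition that is connected and has no empty columns, and let $\nu$ be a partition that is representable with respect to $\lambda/\mu$. Let $M=\#\nu$, let $r+1$ be the number of irreducible components of $\nu$, and let $n_0,n_1,\ldots,n_r$ be their degrees. Then \[ \sum_{T\in\operatorname{RPP}^{12}(\lambda/\mu;\nu)}\mathbf x^{\operatorname{ircont}(T)}=(x_1x_2)^{M}P_{n_0}(x_1,x_2)P_{n_1}(x_1,x_2)\cdots P_{n_r}(x_1,x_2), \] where $P_n(x_1,x_2)=x_1^n+x_1^{n-1}x_2+\cdots+x_1x_2^{n-1}+x_2^n$.
   Context: A partition $\lambda=(\lambda_1\ge\lambda_2\ge\cdots)$ is identified with its Young diagram $\{(i,j)\in\mathbb N_+^2\mid j\le\lambda_i\}$ ($i$ is the row, growing downwards; $j$ is the column). A skew partition $\lambda/\mu$ is a pair of partitions with $\mu\subseteq\lambda$, also identified with the set difference of the diagrams. "Connected" means connected as a subgraph of $\mathbb Z^2$, two cells being adjacent if they share an edge; "no empty columns" means each of the columns $1,\ldots,\lambda_1$ contains a cell of $\lambda/\mu$. A 12-rpp of shape $\lambda/\mu$ is a map $T:\lambda/\mu\to\{1,2\}$ weakly increasing from left to right along rows and from top to bottom down columns. $\operatorname{ircont}(T)=(r_1,r_2,0,0,\ldots)$, where $r_i$ is the number of columns of $T$ containing an entry $i$; $\mathbf x^{\operatorname{ircont}(T)}=x_1^{r_1}x_2^{r_2}$. For a 12-rpp $T$, let $\{(i_1,j_1),\ldots,(i_s,j_s)\}$ with $j_1<\cdots<j_s$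 be the set of all cells $(i,j)\in\lambda/\mu$ with $T(i,j)=1$, $(i+1,j)\in\lambda/\mu$ and $T(i+1,j)=2$. Then $i_1\ge\cdots\ge i_s$, and $\operatorname{seplist}(T):=(i_1,\ldots,i_s)$ (a partition). $\operatorname{RPP}^{12}(\lambda/\mu;\nu)$ is the set of all 12-rpps $T$ of shape $\lambda/\mu$ with $\operatorname{seplist}(T)=\nu$. For a positive integer $i$, $\operatorname{supp}(i)=\{j\mid (i,j),(i+1,j)\in\lambda/\mu\}=[\mu_i+1,\lambda_{i+1}]$ (an integer interval). A partition $\nu=(i_1\ge\cdots\ge i_s>0)$ of length $\#\nu=s$ is admissible if $\operatorname{supp}(i_k)\ne\varnothing$ for all $k$. For integers $a\le b$, $\nu|_{\subseteq[a,b)}$ (resp. $\nu|_{\cap[a,b)}$) is the subpartition of $\nu$ consisting of those entries $i_k$ (counted with multiplicity) with $\operatorname{supp}(i_k)\subseteq[a,b)$ (resp. $\operatorname{supp}(i_k)\cap[a,b)\ne\varnothing$); $\#$ denotes the number of entries. An admissible $\nu$ is representable if $\#\nu|_{\subseteq[a,b)}\le b-a$ for all integers $a<b$. Irreducible components: for representable $\nu$ there are a unique $r\ge 0$ and unique integers $1=b_0\le a_1<b_1<a_2<b_2<\cdots<a_r<b_r\le a_{r+1}=\lambda_1+1$ such that (1) $\#\nu|_{\subseteq[a_k,b_k)}=b_k-a_k$ for all $1\le k\le r$, and (2) the set $\bigcup_{k=0}^r[b_k,a_{k+1})$ is minimal with respect to inclusion among all such sequences satisfying (1). The irreducible components of $\nu$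 are the subpartitions $\nu|_{\cap[b_k,a_{k+1})}$ for $0\le k\le r$, and their degrees are $n_k=a_{k+1}-b_k-\#\nu|_{\cap[b_k,a_{k+1})}$ (nonnegative integers). *)

theory Defs
  imports "HOL-Library.FuncSet" "HOL-Library.Poly_Mapping"
begin

text \<open>A partition is the weakly decreasing list of its nonzero parts, so that \<open>length\<close> is the
  number of parts. Parts, rows and columns are numbered from 1.\<close>

definition is_partition :: "nat list \<Rightarrow> bool" where
  "is_partition p \<longleftrightarrow> sorted_wrt (\<ge>) p \<and> 0 \<notin> set p"

definition part :: "nat list \<Rightarrow> nat \<Rightarrow> nat" where
  "part p i = (if 1 \<le> i \<and> i \<le> length p then p ! (i - 1) else 0)"

type_synonym cell = "nat \<times> nat"

definition diagram :: "nat list \<Rightarrow> cell set" where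
  "diagram p = {(i, j). 1 \<le> i \<and> 1 \<le> j \<and> j \<le> part p i}"

definition is_skew_partition :: "nat list \<Rightarrow> nat list \<Rightarrow> bool" where
  "is_skew_partition lam mu \<longleftrightarrow>
     is_partition lam \<and> is_partition mu \<and> diagram mu \<subseteq> diagram lam"

definition skew :: "nat list \<Rightarrow> nat list \<Rightarrow> cell set" where
  "skew lam mu = diagram lam - diagram mu"

definition adjacent :: "cell \<Rightarrow> cell \<Rightarrow> bool" where
  "adjacent c d \<longleftrightarrow>
     (fst c = fst d \<and> (snd d = snd c + 1 \<or> snd c = snd d + 1)) \<or>
     (snd c = snd d \<and> (fst d = fst c + 1 \<or> fst c = fst d + 1))"

text \<open>The empty set of cells counts as connected.\<close>

definition connected_cells :: "cell set \<Rightarrow> bool" where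
  "connected_cells S \<longleftrightarrow>
     (\<forall>c\<in>S. \<forall>d\<in>S. (c, d) \<in> {(u, v). u \<in> S \<and> v \<in> S \<and> adjacent u v}\<^sup>*)"

definition no_empty_columns :: "nat list \<Rightarrow> nat list \<Rightarrow> bool" where
  "no_empty_columns lam mu \<longleftrightarrow> (\<forall>j\<in>{1..part lam 1}. \<exists>i. (i, j) \<in> skew lam mu)"

text \<open>Extensional functions make distinct elements of \<open>rpp12\<close> distinct fillings of the shape.\<close>

definition rpp12 :: "cell set \<Rightarrow> (cell \<Rightarrow> nat) set" where
  "rpp12 S = {T \<in> S \<rightarrow>\<^sub>E {1, 2}.
     (\<forall>i j j'. (i, j) \<in> S \<and> (i, j') \<in> S \<and> j \<le> j' \<longrightarrow> T (i, j) \<le> T (i, j')) \<and>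
     (\<forall>i i' j. (i, j) \<in> S \<and> (i', j) \<in> S \<and> i \<le> i' \<longrightarrow> T (i, j) \<le> T (i', j))}"

definition ircont :: "cell set \<Rightarrow> (cell \<Rightarrow> nat) \<Rightarrow> nat \<Rightarrow> nat" where
  "ircont S T k = card {j. \<exists>i. (i, j) \<in> S \<and> T (i, j) = k}"

definition sep_cells :: "cell set \<Rightarrow> (cell \<Rightarrow> nat) \<Rightarrow> cell set" where
  "sep_cells S T =
     {(i, j). (i, j) \<in> S \<and> (i + 1, j) \<in> S \<and> T (i, j) = 1 \<and> T (i + 1, j) = 2}"

text \<open>The rows of the separating cells, read in increasing order of columns. A column of a 12-rpp
  contains at most one such cell.\<close>

definition seplist :: "cell set \<Rightarrow> (cell \<Rightarrow> nat) \<Rightarrow> nat list" where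
  "seplist S T =
     map (\<lambda>j. THE i. (i, j) \<in> sep_cells S T) (sorted_list_of_set (snd ` sep_cells S T))"

definition RPP12 :: "nat list \<Rightarrow> nat list \<Rightarrow> nat list \<Rightarrow> (cell \<Rightarrow> nat) set" where
  "RPP12 lam mu nu = {T \<in> rpp12 (skew lam mu). seplist (skew lam mu) T = nu}"

definition supp :: "nat list \<Rightarrow> nat list \<Rightarrow> nat \<Rightarrow> int set" where
  "supp lam mu i = int ` {j. (i, j) \<in> skew lam mu \<and> (i + 1, j) \<in> skew lam mu}"

definition sub_inside :: "nat list \<Rightarrow> nat list \<Rightarrow> nat list \<Rightarrow> int \<Rightarrow> int \<Rightarrow> nat list" where
  "sub_inside lam mu nu a b = filter (\<lambda>i. supp lam mu i \<subseteq> {a..<b}) nu"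

definition sub_meeting :: "nat list \<Rightarrow> nat list \<Rightarrow> nat list \<Rightarrow> int \<Rightarrow> int \<Rightarrow> nat list" where
  "sub_meeting lam mu nu a b = filter (\<lambda>i. supp lam mu i \<inter> {a..<b} \<noteq> {}) nu"

definition admissible :: "nat list \<Rightarrow> nat list \<Rightarrow> nat list \<Rightarrow> bool" where
  "admissible lam mu nu \<longleftrightarrow> is_partition nu \<and> (\<forall>i\<in>set nu. supp lam mu i \<noteq> {})"

definition representable :: "nat list \<Rightarrow> nat list \<Rightarrow> nat list \<Rightarrow> bool" where
  "representable lam mu nu \<longleftrightarrow> admissible lam mu nu \<and>
     (\<forall>a b. a < b \<longrightarrow> int (length (sub_inside lam mu nu a b)) \<le> b - a)"

text \<open>A sequence \<open>1 = b\<^sub>0 \<le> a\<^sub>1 < b\<^sub>1 < a\<^sub>2 < \<dots> < a\<^sub>r < b\<^sub>r \<le> a\<^bsub>r+1\<^esub> = lam\<^sub>1 + 1\<close>; only the values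
  \<open>b 0, \<dots>, b r\<close> and \<open>a 1, \<dots>, a (r + 1)\<close> matter.\<close>

definition interlaced :: "nat list \<Rightarrow> nat \<Rightarrow> (nat \<Rightarrow> int) \<Rightarrow> (nat \<Rightarrow> int) \<Rightarrow> bool" where
  "interlaced lam r a b \<longleftrightarrow>
     b 0 = 1 \<and> b 0 \<le> a 1 \<and>
     (\<forall>k\<in>{1..r}. a k < b k) \<and> (\<forall>k\<in>{1..<r}. b k < a (k + 1)) \<and>
     b r \<le> a (r + 1) \<and> a (r + 1) = int (part lam 1) + 1"

definition tight_sequence ::
  "nat list \<Rightarrow> nat list \<Rightarrow> nat list \<Rightarrow> nat \<Rightarrow> (nat \<Rightarrow> int) \<Rightarrow> (nat \<Rightarrow> int) \<Rightarrow> bool" where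
  "tight_sequence lam mu nu r a b \<longleftrightarrow> interlaced lam r a b \<and>
     (\<forall>k\<in>{1..r}. int (length (sub_inside lam mu nu (a k) (b k))) = b k - a k)"

definition free_columns :: "nat \<Rightarrow> (nat \<Rightarrow> int) \<Rightarrow> (nat \<Rightarrow> int) \<Rightarrow> int set" where
  "free_columns r a b = (\<Union>k\<in>{0..r}. {b k..<a (k + 1)})"

definition irreducible_decomposition ::
  "nat list \<Rightarrow> nat list \<Rightarrow> nat list \<Rightarrow> nat \<Rightarrow> (nat \<Rightarrow> int) \<Rightarrow> (nat \<Rightarrow> int) \<Rightarrow> bool" where
  "irreducible_decomposition lam mu nu r a b \<longleftrightarrow> tight_sequence lam mu nu r a b \<and>
     (\<forall>r' a' b'. tight_sequence lam mu nu r' a' b' \<longrightarrow>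
        \<not> free_columns r' a' b' \<subset> free_columns r a b)"

definition irreducible_component ::
  "nat list \<Rightarrow> nat list \<Rightarrow> nat list \<Rightarrow> (nat \<Rightarrow> int) \<Rightarrow> (nat \<Rightarrow> int) \<Rightarrow> nat \<Rightarrow> nat list" where
  "irreducible_component lam mu nu a b k = sub_meeting lam mu nu (b k) (a (k + 1))"

definition component_degree ::
  "nat list \<Rightarrow> nat list \<Rightarrow> nat list \<Rightarrow> (nat \<Rightarrow> int) \<Rightarrow> (nat \<Rightarrow> int) \<Rightarrow> nat \<Rightarrow> int" where
  "component_degree lam mu nu a b k =
     a (k + 1) - b k - int (length (irreducible_component lam mu nu a b k))"

text \<open>Every \<open>nu\<close> has an irreducible decomposition, since the trivial sequence with \<open>r = 0\<close> is
  tight.\<close>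

lemma irreducible_decomposition_exists:
  "\<exists>r a b. irreducible_decomposition lam mu nu r a b"
proof -
  let ?P = "\<lambda>(r, a, b). tight_sequence lam mu nu r a b"
  let ?f = "\<lambda>(r, a, b). card (free_columns r a b)"
  have "?P (0, \<lambda>_. int (part lam 1) + 1, \<lambda>_. 1)"
    by (simp add: tight_sequence_def interlaced_def)
  then obtain x where x: "?P x" "\<And>y. ?P y \<Longrightarrow> ?f x \<le> ?f y"
    using ex_has_least_nat[of ?P _ ?f] by blast
  obtain r a b where [simp]: "x = (r, a, b)" by (cases x)
  have "\<not> free_columns r' a' b' \<subset> free_columns r a b"
    if "tight_sequence lam mu nu r' a' b'" for r' a' b'
  proof
    assume *: "free_columns r' a' b' \<subset> free_columns r a b"
    have "finite (free_columns r a b)" by (simp add: free_columns_def)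
    from psubset_card_mono[OF this *] x(2)[of "(r', a', b')"] that show False by simp
  qed
  with x(1) show ?thesis unfolding irreducible_decomposition_def by auto
qed

text \<open>Polynomials with coefficients in \<open>'k\<close> in indeterminates indexed by natural numbers: finitely
  supported functions from monomials (finitely supported exponent vectors) to \<open>'k\<close>, with the
  convolution product.\<close>

type_synonym 'k polys = "(nat \<Rightarrow>\<^sub>0 nat) \<Rightarrow>\<^sub>0 'k"

definition X :: "nat \<Rightarrow> 'k::comm_ring_1 polys" where
  "X i = Poly_Mapping.single (Poly_Mapping.single i 1) 1"

definition x_power :: "(nat \<Rightarrow> nat) \<Rightarrow> 'k::comm_ring_1 polys" where
  "x_power r = X 1 ^ r 1 * X 2 ^ r 2"

definition P :: "nat \<Rightarrow> 'k::comm_ring_1 polys" where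
  "P n = (\<Sum>i=0..n. X 1 ^ (n - i) * X 2 ^ i)"

end

theory Submission
  imports Defs
begin

text \<open>A column of a 12-rpp is all 1, all 2 (pure), or mixed. The \<open>k\<close>-th mixed column separates in row
  \<open>nu\<^sub>k\<close>, and monotonicity along rows only forbids the following neighbours: 2 before 1; the \<open>k\<close>-th
  mixed column before 1, unless it is the last column of its support; 2 before the \<open>k\<close>-th mixed
  column, unless it is the first column of its support. Hence the word in 1 and 2 given by the pure
  columns determines the 12-rpp: the number of pure columns left of the \<open>k\<close>-th mixed column has to be
  the least admissible \<open>x\<close> that is maximal or is followed by a 2. This word can have a 2 followed by
  a 1 only where a run of mixed columns lies between them that fills a tight interval, and there
  every such word occurs. The tight intervals are covered by the blocks of the irreducible
  decomposition, so the word consists of \<open>r + 1\<close> independent factors \<open>1\<^sup>p 2\<^sup>q\<close> whose lengths are the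
  component degrees.\<close>

section \<open>Ranks and words with prescribed descents\<close>

text \<open>Representability is Hall's condition for assigning to the entries distinct columns of
  their supports. Both ends of the supports grow with the index, so it yields
  \<open>L i + k \<le> R k + i\<close> for every range of indices from \<open>i\<close> to
  \<open>k\<close>, with equality only when the interval from \<open>L i\<close> to
  \<open>R k\<close> is tight. The mixed column number \<open>k\<close> with \<open>x\<close> pure
  columns to its left is column \<open>k + x\<close>, so the conditions on its place become bounds
  on \<open>x\<close> by the numbers \<open>L i - i\<close> and \<open>R i - i\<close>.
  Connectedness enters once: neighbouring columns share a row, so a column of 2s cannot stand
  directly before a column of 1s. That the blocks cover all tight intervals rests on submodularity
  of the counts: tight intervals that overlap or touch have a tight union.\<close>

definition rank :: "nat set \<Rightarrow> nat \<Rightarrow> nat" where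
  "rank J j = card (J \<inter> {1..j})"

lemma rank_0 [simp]: "rank J 0 = 0"
  by (simp add: rank_def)

lemma rank_Suc: "rank J (Suc j) = rank J j + (if Suc j \<in> J then 1 else 0)"
proof -
  have "J \<inter> {1..Suc j} = (if Suc j \<in> J then insert (Suc j) (J \<inter> {1..j}) else J \<inter> {1..j})"
    by (auto simp: le_Suc_eq)
  then show ?thesis by (auto simp: rank_def)
qed

lemma rank_mono: "i \<le> j \<Longrightarrow> rank J i \<le> rank J j"
  by (auto simp: rank_def intro!: card_mono)

lemma rank_less:
  assumes "i < j" "j \<in> J"
  shows "rank J i < rank J j"
proof -
  obtain j' where j': "j = Suc j'" using assms by (cases j) auto
  have "rank J i \<le> rank J j'" using assms j' by (intro rank_mono) simp
  then show ?thesis using assms j' by (simp add: rank_Suc)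
qed

lemma rank_inj: "i \<in> J \<Longrightarrow> j \<in> J \<Longrightarrow> rank J i = rank J j \<Longrightarrow> i = j"
  using rank_less[of i j J] rank_less[of j i J] by (cases i j rule: linorder_cases) auto

lemma rank_surj:
  assumes "1 \<le> k" "k \<le> rank J n"
  obtains j where "j \<in> J" "1 \<le> j" "j \<le> n" "rank J j = k"
proof -
  define j where "j = (LEAST j. k \<le> rank J j)"
  have j: "k \<le> rank J j" "j \<le> n"
    unfolding j_def using assms(2) by (auto intro: LeastI Least_le)
  obtain i where i: "j = Suc i" using j assms by (cases j) auto
  have "\<not> k \<le> rank J i" using i not_less_Least[of i "\<lambda>j. k \<le> rank J j"] by (simp add: j_def[symmetric])
  then have "j \<in> J" "rank J j = k" using j i by (auto simp: rank_Suc split: if_splits)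
  then show ?thesis using that i j by simp
qed

lemma rank_complement: "j \<le> n \<Longrightarrow> rank J j + rank ({1..n} - J) j = j"
proof (induction j)
  case (Suc j)
  then show ?case by (auto simp: rank_Suc)
qed simp

lemma rank_eq_card: "J \<subseteq> {1..n} \<Longrightarrow> rank J n = card J"
  by (simp add: rank_def Int_absorb2)

lemma sorted_list_of_set_nth_rank:
  assumes "J \<subseteq> {1..n}" "m < card J"
  shows "rank J (sorted_list_of_set J ! m) = Suc m"
proof -
  let ?xs = "sorted_list_of_set J"
  have fin: "finite J" using assms(1) finite_subset by blast
  have less: "?xs ! i < ?xs ! k" if "i < k" "k < card J" for i k
    using sorted_wrt_nth_less[OF strict_sorted_list_of_set[of J]] that by simp
  have "J \<inter> {1..?xs ! m} = (!) ?xs ` {..m}"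
  proof
    show "(!) ?xs ` {..m} \<subseteq> J \<inter> {1..?xs ! m}"
    proof
      fix j assume "j \<in> (!) ?xs ` {..m}"
      then obtain i where i: "i \<le> m" "j = ?xs ! i" by auto
      then have "j \<in> J" using nth_mem[of i ?xs] fin assms(2) by simp
      moreover have "j \<le> ?xs ! m" using less[of i m] i assms(2) by (cases "i = m") auto
      ultimately show "j \<in> J \<inter> {1..?xs ! m}" using assms(1) by auto
    qed
    show "J \<inter> {1..?xs ! m} \<subseteq> (!) ?xs ` {..m}"
    proof
      fix j assume j: "j \<in> J \<inter> {1..?xs ! m}"
      then obtain i where i: "i < card J" "j = ?xs ! i"
        using fin by (metis IntD1 in_set_conv_nth length_sorted_list_of_set set_sorted_list_of_set)
      then have "i \<le> m" using less[of m i] j by fastforce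
      then show "j \<in> (!) ?xs ` {..m}" using i by auto
    qed
  qed
  moreover have "inj_on ((!) ?xs) {..m}"
    using assms(2) by (intro inj_on_nth) auto
  ultimately show ?thesis by (simp add: rank_def card_image)
qed

text \<open>Turns equality with a list read off in column order into a condition on each column and
  its rank, the form in which \<open>nu_heights\<close> prescribes the separating rows.\<close>

lemma map_sorted_list_of_set_eq_iff:
  assumes J: "J \<subseteq> {1..n}"
  shows "map h (sorted_list_of_set J) = xs \<longleftrightarrow>
    card J = length xs \<and> (\<forall>j\<in>J. h j = xs ! (rank J j - 1))"
proof
  let ?js = "sorted_list_of_set J"
  have fin: "finite J" using J finite_subset by blast
  note r = sorted_list_of_set_nth_rank[OF J]
  have idx: "\<exists>m<card J. j = ?js ! m" if "j \<in> J" for j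
    using fin that by (metis in_set_conv_nth length_sorted_list_of_set set_sorted_list_of_set)
  {
    assume eq: "map h ?js = xs"
    then have "card J = length xs" using length_map[of h ?js] by simp
    moreover have "h j = xs ! (rank J j - 1)" if "j \<in> J" for j
      using idx[OF that] r eq by auto
    ultimately show "card J = length xs \<and> (\<forall>j\<in>J. h j = xs ! (rank J j - 1))" by blast
  next
    assume a: "card J = length xs \<and> (\<forall>j\<in>J. h j = xs ! (rank J j - 1))"
    show "map h ?js = xs"
    proof (rule nth_equalityI)
      fix m assume "m < length (map h ?js)"
      then have m: "m < card J" by simp
      then have "?js ! m \<in> J" using nth_mem[of m ?js] fin by simp
      then show "map h ?js ! m = xs ! m" using a r[OF m] m by simp
    qed (use a in simp)
  }
qed

text \<open>A word of length \<open>m\<close> in 1 and 2 is given by the set \<open>A\<close> of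
  positions of its 1s; a 2 at position \<open>c\<close> may be followed by a 1 only if
  \<open>c\<close> lies in \<open>C\<close>. Positions start at 1, hence the guard on
  \<open>c\<close>.\<close>

definition descent_sets :: "nat set \<Rightarrow> nat \<Rightarrow> nat set set" where
  "descent_sets C m = {A. A \<subseteq> {1..m} \<and> (\<forall>c. 1 \<le> c \<and> c \<notin> A \<and> Suc c \<in> A \<longrightarrow> c \<in> C)}"

lemma down_closed_eq_interval:
  fixes D :: "nat set"
  assumes D: "D \<subseteq> {m<..m'}" and down: "\<And>c. m < c \<Longrightarrow> Suc c \<in> D \<Longrightarrow> c \<in> D"
  shows "D = {m<..m + card D}"
proof (cases "D = {}")
  case False
  have fin: "finite D" using D finite_subset by blast
  define t where "t = Max D"
  have t: "t \<in> D" using fin False by (simp add: t_def)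
  have "c \<in> D" if "c \<le> t" "m < c" for c
    using that
  proof (induction c rule: inc_induct)
    case (step c)
    then show ?case using down[of c] by simp
  qed (rule t)
  then have eq: "D = {m<..t}" using D Max_ge[OF fin] by (auto simp: t_def)
  have "m < t" using t D by auto
  then show ?thesis using eq by simp
qed simp

text \<open>No descent is allowed beyond \<open>m\<close>, so the part of the word after
  \<open>m\<close> is a run of 1s followed by \<open>i\<close> 2s. The part up to \<open>m\<close>
  is any word with descents in \<open>C\<close>, and as a descent at \<open>m\<close> itself is
  allowed, the two parts are independent.\<close>

lemma sum_descent_sets_step:
  fixes x y :: "'a::comm_semiring_1"
  assumes C: "C \<subseteq> {..m}" and m: "m \<le> m'"
  shows "(\<Sum>A\<in>descent_sets (insert m C) m'. x ^ card A * y ^ (m' - card A)) =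
    (\<Sum>A\<in>descent_sets C m. x ^ card A * y ^ (m - card A)) *
    (\<Sum>i=0..m' - m. x ^ (m' - m - i) * y ^ i)"
proof -
  let ?f = "\<lambda>(A, i). A \<union> {m<..m' - i}"
  let ?g = "\<lambda>B. (B \<inter> {1..m}, m' - m - card (B \<inter> {m<..m'}))"
  have inter: "B \<inter> {m<..m'} = {m<..m + card (B \<inter> {m<..m'})}"
    if "B \<in> descent_sets (insert m C) m'" for B
  proof (rule down_closed_eq_interval)
    fix c assume c: "m < c" "Suc c \<in> B \<inter> {m<..m'}"
    have "c \<notin> insert m C" "1 \<le> c" using c C by auto
    then have "c \<in> B" using that c unfolding descent_sets_def by blast
    then show "c \<in> B \<inter> {m<..m'}" using c by simp
  qed (rule Int_lower2)
  have "(\<Sum>A\<in>descent_sets C m. x ^ card A * y ^ (m - card A)) *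
      (\<Sum>i=0..m' - m. x ^ (m' - m - i) * y ^ i) =
    (\<Sum>(A, i)\<in>descent_sets C m \<times> {0..m' - m}.
      (x ^ card A * y ^ (m - card A)) * (x ^ (m' - m - i) * y ^ i))"
    by (simp add: sum_product sum.cartesian_product)
  also have "\<dots> = (\<Sum>B\<in>descent_sets (insert m C) m'. x ^ card B * y ^ (m' - card B))"
  proof (rule sum.reindex_bij_witness[of _ ?g ?f])
    fix p assume "p \<in> descent_sets C m \<times> {0..m' - m}"
    then obtain A i where p: "p = (A, i)" and A: "A \<in> descent_sets C m" and i: "i \<le> m' - m"
      by auto
    have Am: "A \<subseteq> {1..m}" using A by (simp add: descent_sets_def)
    have fin: "finite A" using Am finite_subset by blast
    have "?f p \<inter> {1..m} = A" "?f p \<inter> {m<..m'} = {m<..m' - i}"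
      using Am m by (auto simp: p)
    then show "?g (?f p) = p" using i by (simp add: p)
    show "?f p \<in> descent_sets (insert m C) m'"
    proof -
      have "c \<in> insert m C" if "1 \<le> c" "c \<notin> ?f p" "Suc c \<in> ?f p" for c
      proof (cases "Suc c \<in> A")
        case True
        then show ?thesis using that A by (auto simp: p descent_sets_def)
      next
        case False
        then show ?thesis using that by (auto simp: p)
      qed
      then show ?thesis using Am m i by (auto simp: p descent_sets_def)
    qed
    have "A \<inter> {m<..m' - i} = {}" using Am by auto
    then have "card (?f p) = card A + (m' - i - m)"
      using fin by (simp add: p card_Un_disjoint)
    moreover have "card A \<le> m" using card_mono[OF _ Am] by simp
    ultimately have "card (?f p) = card A + (m' - m - i)" "m' - card (?f p) = m - card A + i"
      using i m by auto
    then show "x ^ card (?f p) * y ^ (m' - card (?f p)) =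
        (case p of (A, i) \<Rightarrow> (x ^ card A * y ^ (m - card A)) * (x ^ (m' - m - i) * y ^ i))"
      by (simp add: p power_add algebra_simps)
  next
    fix B assume B: "B \<in> descent_sets (insert m C) m'"
    have "card (B \<inter> {m<..m'}) \<le> m' - m" using card_mono[of "{m<..m'}" "B \<inter> {m<..m'}"] by simp
    then have "{m<..m' - (m' - m - card (B \<inter> {m<..m'}))} = B \<inter> {m<..m'}"
      using inter[OF B] m by simp
    then show "?f (?g B) = B" using B m by (auto simp: descent_sets_def)
    have "B \<inter> {1..m} \<in> descent_sets C m"
    proof -
      have "c \<in> C" if "1 \<le> c" "c \<notin> B \<inter> {1..m}" "Suc c \<in> B \<inter> {1..m}" for c
        using that B by (auto simp: descent_sets_def)
      then show ?thesis by (auto simp: descent_sets_def)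
    qed
    then show "?g B \<in> descent_sets C m \<times> {0..m' - m}" by simp
  qed
  finally show ?thesis ..
qed

text \<open>The last factor is split off repeatedly. Equal consecutive values of \<open>N\<close>
  contribute the factor 1; they occur for components of degree 0.\<close>

lemma sum_descent_sets:
  fixes x y :: "'a::comm_semiring_1"
  assumes N0: "N 0 = 0" and mono: "\<And>i. i < k \<Longrightarrow> N i \<le> N (Suc i)"
  shows "(\<Sum>A\<in>descent_sets (N ` {..<k}) (N k). x ^ card A * y ^ (N k - card A)) =
    (\<Prod>i<k. \<Sum>j=0..N (Suc i) - N i. x ^ (N (Suc i) - N i - j) * y ^ j)"
  using mono
proof (induction k)
  case 0
  have "descent_sets {} 0 = {{}}" by (auto simp: descent_sets_def)
  then show ?case by (simp add: N0)
next
  case (Suc k)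
  have "N i \<le> N k" if "i \<le> k" for i
    using that
  proof (induction i rule: inc_induct)
    case (step i)
    then show ?case using Suc.prems[of i] by simp
  qed simp
  then have "N ` {..<k} \<subseteq> {..N k}" by auto
  then show ?case
    using sum_descent_sets_step[of "N ` {..<k}" "N k" "N (Suc k)" x y] Suc.IH Suc.prems
    by (simp add: lessThan_Suc mult.commute)
qed

section \<open>12-rpps and words of pure columns\<close>

text \<open>Column \<open>j\<close> of the shape occupies the rows \<open>s j + 1, \<dots>, u j\<close>, and \<open>{L k..R k}\<close> is the support of the
  \<open>k\<close>-th entry \<open>nu k\<close>. A 12-rpp is encoded by the heights \<open>h j\<close>, the last row of column \<open>j\<close> with an
  entry 1 (and \<open>s j\<close> if there is none).\<close>

locale column_data =
  fixes n M :: nat and s u nu L R :: "nat \<Rightarrow> nat"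
  assumes s_anti: "1 \<le> j \<Longrightarrow> j < n \<Longrightarrow> s (Suc j) \<le> s j"
    and u_anti: "1 \<le> j \<Longrightarrow> j < n \<Longrightarrow> u (Suc j) \<le> u j"
    and s_less_u: "1 \<le> j \<Longrightarrow> j \<le> n \<Longrightarrow> s j < u j"
    and overlap: "1 \<le> j \<Longrightarrow> j < n \<Longrightarrow> s j < u (Suc j)"
    and nu_anti: "1 \<le> k \<Longrightarrow> k < M \<Longrightarrow> nu (Suc k) \<le> nu k"
    and supp_iff: "1 \<le> k \<Longrightarrow> k \<le> M \<Longrightarrow>
      L k \<le> j \<and> j \<le> R k \<longleftrightarrow> 1 \<le> j \<and> j \<le> n \<and> s j < nu k \<and> nu k < u j"
    and hall: "1 \<le> i \<Longrightarrow> i \<le> k \<Longrightarrow> k \<le> M \<Longrightarrow> L i + k \<le> R k + i"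
begin

definition heights :: "(nat \<Rightarrow> nat) set" where
  "heights = {h \<in> extensional {1..n}. (\<forall>j\<in>{1..n}. s j \<le> h j \<and> h j \<le> u j) \<and>
     (\<forall>j. 1 \<le> j \<and> j < n \<longrightarrow> h (Suc j) \<le> h j)}"

definition mixed :: "(nat \<Rightarrow> nat) \<Rightarrow> nat set" where
  "mixed h = {j \<in> {1..n}. s j < h j \<and> h j < u j}"

definition pure1 :: "(nat \<Rightarrow> nat) \<Rightarrow> nat set" where
  "pure1 h = {j \<in> {1..n}. h j = u j}"

definition nu_heights :: "(nat \<Rightarrow> nat) set" where
  "nu_heights = {h \<in> heights. card (mixed h) = M \<and>
     (\<forall>j\<in>mixed h. h j = nu (rank (mixed h) j))}"

text \<open>The word of \<open>h\<close>: the positions of the 1s when only the pure columns are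
  counted.\<close>

definition ones :: "(nat \<Rightarrow> nat) \<Rightarrow> nat set" where
  "ones h = rank ({1..n} - mixed h) ` pure1 h"

text \<open>Number the pure columns from left to right. For \<open>i\<close>, \<open>k\<close> as below, the interval \<open>{L i..R k}\<close> has
  \<open>k - i + 1\<close> columns, so in every 12-rpp it consists of the mixed columns number \<open>i, \<dots>, k\<close>, and
  these lie between the pure columns number \<open>c\<close> and \<open>c + 1\<close>.\<close>

definition cut :: "nat \<Rightarrow> bool" where
  "cut c \<longleftrightarrow> (\<exists>i k. 1 \<le> i \<and> i \<le> k \<and> k \<le> M \<and> L i = i + c \<and> R k = k + c)"

text \<open>\<open>lo k x \<and> hi k x\<close> says that the intervals allow \<open>x\<close> pure columns left of the \<open>k\<close>-th mixed column;
  \<open>shift A k\<close> is the number that is forced once the set \<open>A\<close> of pure columns with entry 1 is fixed.\<close>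

definition lo :: "nat \<Rightarrow> nat \<Rightarrow> bool" where
  "lo k x \<longleftrightarrow> (\<forall>i\<in>{1..k}. L i \<le> i + x)"

definition hi :: "nat \<Rightarrow> nat \<Rightarrow> bool" where
  "hi k x \<longleftrightarrow> (\<forall>i\<in>{k..M}. i + x \<le> R i)"

definition shift :: "nat set \<Rightarrow> nat \<Rightarrow> nat" where
  "shift A k = (LEAST x. lo k x \<and> (hi k (Suc x) \<longrightarrow> Suc x \<notin> A))"

text \<open>To the left of the \<open>k\<close>-th mixed column there are \<open>k - 1\<close> mixed
  and \<open>shift A k\<close> pure columns.\<close>

definition mixed_of :: "nat set \<Rightarrow> nat set" where
  "mixed_of A = (\<lambda>k. k + shift A k) ` {1..M}"

definition height_of :: "nat set \<Rightarrow> nat \<Rightarrow> nat" where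
  "height_of A = restrict (\<lambda>j. if j \<in> mixed_of A then nu (rank (mixed_of A) j)
     else if rank ({1..n} - mixed_of A) j \<in> A then u j else s j) {1..n}"

lemma L_ge_1: "1 \<le> k \<Longrightarrow> k \<le> M \<Longrightarrow> 1 \<le> L k"
  using supp_iff[of k "L k"] hall[of k k] by auto

lemma R_le: "1 \<le> k \<Longrightarrow> k \<le> M \<Longrightarrow> R k \<le> n"
  using supp_iff[of k "R k"] hall[of k k] by auto

lemma M_le: "M \<le> n"
  using hall[of 1 M] L_ge_1[of 1] R_le[of M] by (cases "M = 0") auto

lemma pure1_not_mixed: "j \<in> pure1 h \<Longrightarrow> j \<in> {1..n} - mixed h"
  by (auto simp: pure1_def mixed_def)

section \<open>From a filling to its word of pure columns\<close>

context
  fixes h assumes h: "h \<in> nu_heights"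
begin

lemma heights_mono: "1 \<le> j \<Longrightarrow> j < n \<Longrightarrow> h (Suc j) \<le> h j"
  and heights_bounds: "1 \<le> j \<Longrightarrow> j \<le> n \<Longrightarrow> s j \<le> h j \<and> h j \<le> u j"
  using h by (auto simp: nu_heights_def heights_def)

lemma mixed_subset: "mixed h \<subseteq> {1..n}"
  by (auto simp: mixed_def)

lemma rank_mixed_n: "rank (mixed h) n = M"
  using h rank_eq_card[OF mixed_subset] by (simp add: nu_heights_def)

lemma rank_sum: "j \<le> n \<Longrightarrow> rank (mixed h) j + rank ({1..n} - mixed h) j = j"
  by (rule rank_complement)

lemma rank_pure_n: "rank ({1..n} - mixed h) n = n - M"
  using rank_sum[of n] rank_mixed_n by simp

lemma rank_mixed_bounds:
  assumes "j \<in> mixed h"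
  shows "1 \<le> rank (mixed h) j" "rank (mixed h) j \<le> M"
  using assms rank_less[of 0 j "mixed h"] rank_mono[of j n "mixed h"] rank_mixed_n
  by (auto simp: mixed_def)

lemma mixed_supp:
  assumes "j \<in> mixed h"
  shows "L (rank (mixed h) j) \<le> j" "j \<le> R (rank (mixed h) j)"
  using assms h supp_iff[OF rank_mixed_bounds[OF assms], of j]
  by (auto simp: nu_heights_def mixed_def)

text \<open>Heights decrease, so \<open>u (Suc j)\<close> is at most the separating row of column
  \<open>j\<close>. Hence column \<open>Suc j\<close> is outside the support, which ends at
  \<open>j\<close>.\<close>

lemma mixed_then_pure1:
  assumes "j \<in> mixed h" "Suc j \<in> pure1 h"
  shows "R (rank (mixed h) j) = j"
proof -
  let ?k = "rank (mixed h) j"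
  have "h j = nu ?k" using assms h by (auto simp: nu_heights_def)
  moreover have "h (Suc j) = u (Suc j)" "h (Suc j) \<le> h j"
    using assms heights_mono[of j] by (auto simp: pure1_def mixed_def)
  ultimately have "\<not> (L ?k \<le> Suc j \<and> Suc j \<le> R ?k)"
    using supp_iff[OF rank_mixed_bounds[OF assms(1)], of "Suc j"] by auto
  then show ?thesis using mixed_supp[OF assms(1)] by auto
qed

lemma pure2_then_mixed:
  assumes "Suc j \<in> mixed h" "j \<in> {1..n} - mixed h" "j \<notin> pure1 h"
  shows "L (rank (mixed h) (Suc j)) = Suc j"
proof -
  let ?k = "rank (mixed h) (Suc j)"
  have "h (Suc j) = nu ?k" using assms h by (auto simp: nu_heights_def)
  moreover have "h j = s j" "h (Suc j) \<le> h j"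
    using assms heights_mono[of j] heights_bounds[of j] by (auto simp: pure1_def mixed_def)
  ultimately have "\<not> (L ?k \<le> j \<and> j \<le> R ?k)"
    using supp_iff[OF rank_mixed_bounds[OF assms(1)], of j] by auto
  then show ?thesis using mixed_supp[OF assms(1)] by auto
qed

lemma rank_in_ones: "j \<in> {1..n} - mixed h \<Longrightarrow> rank ({1..n} - mixed h) j \<in> ones h \<longleftrightarrow> j \<in> pure1 h"
  unfolding ones_def
  using rank_inj[of j "{1..n} - mixed h"] pure1_not_mixed[of _ h] by blast

lemma ones_subset: "ones h \<subseteq> {1..n - M}"
proof -
  have "1 \<le> rank ({1..n} - mixed h) j \<and> rank ({1..n} - mixed h) j \<le> n - M" if "j \<in> pure1 h" for j
    using pure1_not_mixed[OF that] rank_less[of 0 j "{1..n} - mixed h"]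
      rank_mono[of j n "{1..n} - mixed h"] rank_pure_n by auto
  then show ?thesis by (auto simp: ones_def)
qed

lemma card_ones: "card (ones h) = card (pure1 h)"
  unfolding ones_def by (rule card_image) (rule inj_onI, rule rank_inj[OF pure1_not_mixed pure1_not_mixed])

text \<open>For \<open>i\<close> up to the given rank, the \<open>i\<close>-th mixed column lies at
  or beyond \<open>L i\<close> and has no more pure columns to its left than column \<open>j\<close>
  has. The bound \<open>hi_mixed\<close> is the mirror image.\<close>

lemma lo_mixed:
  assumes "j \<in> mixed h"
  shows "lo (rank (mixed h) j) (rank ({1..n} - mixed h) j)"
  unfolding lo_def
proof
  fix i assume i: "i \<in> {1..rank (mixed h) j}"
  then obtain e where e: "e \<in> mixed h" "e \<le> j" "rank (mixed h) e = i"
    using rank_surj[of i "mixed h" j] by auto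
  have jn: "j \<le> n" using assms mixed_subset by auto
  show "L i \<le> i + rank ({1..n} - mixed h) j"
    using mixed_supp[OF e(1)] e rank_sum[of e] rank_mono[OF e(2), of "{1..n} - mixed h"] jn by auto
qed

lemma hi_mixed:
  assumes "j \<in> mixed h"
  shows "hi (rank (mixed h) j) (rank ({1..n} - mixed h) j)"
  unfolding hi_def
proof
  fix i assume i: "i \<in> {rank (mixed h) j..M}"
  then obtain e where e: "e \<in> mixed h" "e \<le> n" "rank (mixed h) e = i"
    using rank_surj[of i "mixed h" n] rank_mixed_n rank_mixed_bounds[OF assms] by auto
  have "j \<le> e" using i e assms rank_less[of e j "mixed h"] by fastforce
  then show "i + rank ({1..n} - mixed h) j \<le> R i"
    using mixed_supp[OF e(1)] e rank_sum[of e] rank_mono[of j e "{1..n} - mixed h"] by auto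
qed

text \<open>Between column \<open>j\<close> and the next pure column, here a 1, all columns are
  mixed. The last mixed column before that 1 is at the right end of its support, so one more pure
  column before it does not fit.\<close>

lemma not_hi_mixed:
  assumes j: "j \<in> mixed h" and c: "Suc (rank ({1..n} - mixed h) j) \<in> ones h"
  shows "\<not> hi (rank (mixed h) j) (Suc (rank ({1..n} - mixed h) j))"
proof -
  let ?Z = "{1..n} - mixed h"
  obtain y where y: "y \<in> pure1 h" "rank ?Z y = Suc (rank ?Z j)" using c by (auto simp: ones_def)
  have yZ: "y \<in> ?Z" using y pure1_not_mixed by blast
  obtain x where x: "y = Suc x" using yZ by (cases y) auto
  have jy: "j < y" using y rank_mono[of y j ?Z] by (metis Suc_n_not_le_n not_less)
  have rx: "rank ?Z x = rank ?Z j" using yZ y unfolding x by (simp add: rank_Suc)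
  have xn: "x \<in> {1..n}" using jy x yZ j mixed_subset by auto
  have xJ: "x \<in> mixed h" using rank_less[of j x ?Z] rx jy x xn j by (cases "x = j") auto
  have "R (rank (mixed h) x) = rank (mixed h) x + rank ?Z j"
    using mixed_then_pure1[OF xJ] y x rx rank_sum[of x] xn by simp
  moreover have "rank (mixed h) j \<le> rank (mixed h) x" using jy x by (intro rank_mono) simp
  ultimately show ?thesis
    unfolding hi_def using rank_mixed_bounds[OF xJ] by (auto intro!: bexI[of _ "rank (mixed h) x"])
qed

text \<open>The mirror image: the first mixed column after the preceding pure column, here a 2, is
  at the left end of its support.\<close>

lemma not_lo_mixed:
  assumes j: "j \<in> mixed h" and c: "rank ({1..n} - mixed h) j = Suc c" "Suc c \<notin> ones h"
  shows "\<not> lo (rank (mixed h) j) c"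
proof -
  let ?Z = "{1..n} - mixed h"
  have jn: "j \<le> n" using j mixed_subset by auto
  obtain x where x: "x \<in> ?Z" "x \<le> j" "rank ?Z x = Suc c"
    using rank_surj[of "Suc c" ?Z j] c by auto
  have xj: "x < j" using x j by (cases "x = j") auto
  have "rank ?Z (Suc x) \<le> rank ?Z j" using xj by (intro rank_mono) simp
  then have r: "Suc x \<notin> ?Z" "rank ?Z (Suc x) = Suc c" using c x by (auto simp: rank_Suc split: if_splits)
  have xJ: "Suc x \<in> mixed h" using r xj jn by auto
  have "x \<notin> pure1 h" using c(2) x(3) rank_in_ones[OF x(1)] by simp
  then have "L (rank (mixed h) (Suc x)) = Suc x" using pure2_then_mixed[OF xJ] x by auto
  moreover have "rank (mixed h) (Suc x) + Suc c = Suc x" using rank_sum[of "Suc x"] r xj jn by auto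
  moreover have "rank (mixed h) (Suc x) \<le> rank (mixed h) j" using xj by (intro rank_mono) simp
  ultimately show ?thesis
    unfolding lo_def using rank_mixed_bounds[OF xJ] by (auto intro!: bexI[of _ "rank (mixed h) (Suc x)"])
qed

text \<open>By \<open>overlap\<close> the two pure columns are not neighbours. The first mixed
  column between them is at the left end of its support and the last one at the right end of its
  own, which gives the two equations in \<open>cut\<close>.\<close>

lemma ones_descent:
  assumes c: "1 \<le> c" "c \<notin> ones h" "Suc c \<in> ones h"
  shows "cut c"
proof -
  let ?Z = "{1..n} - mixed h"
  obtain y where y: "y \<in> pure1 h" "rank ?Z y = Suc c" using c by (auto simp: ones_def)
  have yZ: "y \<in> ?Z" using y pure1_not_mixed by blast
  obtain y' where y': "y = Suc y'" using yZ by (cases y) auto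
  have ry': "rank ?Z y' = c" using y yZ unfolding y' by (simp add: rank_Suc)
  obtain x where x: "x \<in> ?Z" "x \<le> y'" "rank ?Z x = c"
    using rank_surj[of c ?Z y'] ry' c by auto
  have xp: "x \<notin> pure1 h" using c x rank_in_ones by auto
  have hx: "h x = s x" using xp x heights_bounds[of x] by (auto simp: pure1_def mixed_def)
  have "x \<noteq> y'"
  proof
    assume "x = y'"
    then have "h y = u y" "h y \<le> h x" "s x < u y"
      using y y' x yZ heights_mono[of x] overlap[of x] by (auto simp: pure1_def)
    then show False using hx by simp
  qed
  then have xy: "x < y'" using x by simp
  have y'n: "y' \<in> {1..n}" using y' yZ xy by auto
  have yJ: "y' \<in> mixed h" using rank_less[OF xy, of ?Z] x ry' y'n by auto
  have "rank ?Z (Suc x) \<le> rank ?Z y'" using xy by (intro rank_mono) simp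
  then have r: "Suc x \<notin> ?Z" "rank ?Z (Suc x) = c" using ry' x by (auto simp: rank_Suc split: if_splits)
  have xJ: "Suc x \<in> mixed h" using r xy y'n by auto
  have "L (rank (mixed h) (Suc x)) = rank (mixed h) (Suc x) + c"
    using pure2_then_mixed[OF xJ x(1) xp] rank_sum[of "Suc x"] r xy y'n by auto
  moreover have "R (rank (mixed h) y') = rank (mixed h) y' + c"
    using mixed_then_pure1[OF yJ] y y' rank_sum[of y'] ry' y'n by auto
  moreover have "rank (mixed h) (Suc x) \<le> rank (mixed h) y'" using xy by (intro rank_mono) simp
  ultimately show ?thesis
    unfolding cut_def using rank_mixed_bounds[OF xJ] rank_mixed_bounds[OF yJ] by blast
qed

end

section \<open>The forced positions of the mixed columns\<close>

abbreviation descents :: "nat set set" where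
  "descents \<equiv> descent_sets {c. cut c} (n - M)"

lemma ones_in_descents: "h \<in> nu_heights \<Longrightarrow> ones h \<in> descents"
  unfolding descent_sets_def using ones_subset ones_descent by blast

lemma shift_least: "lo k x \<Longrightarrow> (hi k (Suc x) \<Longrightarrow> Suc x \<notin> A) \<Longrightarrow> shift A k \<le> x"
  unfolding shift_def by (rule Least_le) blast

lemma shift_props:
  assumes "1 \<le> k" "k \<le> M"
  shows "lo k (shift A k)" "hi k (Suc (shift A k)) \<Longrightarrow> Suc (shift A k) \<notin> A"
proof -
  \<comment> \<open>Some \<open>x\<close> qualifies for every \<open>A\<close>: \<open>n\<close>
    satisfies all lower bounds, and \<open>Suc n\<close> violates the upper bound at
    \<open>k\<close>.\<close>
  have "L i \<le> i + n" if "1 \<le> i" "i \<le> k" for i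
    using hall[of i i] R_le[of i] that assms by auto
  then have "lo k n" by (auto simp: lo_def)
  moreover have "\<not> hi k (Suc n)"
    using R_le[OF assms] assms by (auto simp: hi_def intro!: bexI[of _ k])
  ultimately have "\<exists>x. lo k x \<and> (hi k (Suc x) \<longrightarrow> Suc x \<notin> A)" by blast
  from LeastI_ex[OF this]
  show "lo k (shift A k)" "hi k (Suc (shift A k)) \<Longrightarrow> Suc (shift A k) \<notin> A"
    unfolding shift_def by blast+
qed

lemma loD: "lo k x \<Longrightarrow> 1 \<le> i \<Longrightarrow> i \<le> k \<Longrightarrow> L i \<le> i + x"
  by (simp add: lo_def)

lemma hiD: "hi k x \<Longrightarrow> k \<le> i \<Longrightarrow> i \<le> M \<Longrightarrow> i + x \<le> R i"
  by (simp add: hi_def)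

lemma mixed_ofE:
  assumes "j \<in> mixed_of A"
  obtains k where "1 \<le> k" "k \<le> M" "j = k + shift A k"
  using assms by (auto simp: mixed_of_def)

lemma lo_antimono: "lo k x \<Longrightarrow> i \<le> k \<Longrightarrow> lo i x"
  by (auto simp: lo_def)

lemma hi_antimono: "hi k x \<Longrightarrow> k \<le> i \<Longrightarrow> hi i x"
  by (auto simp: hi_def)

text \<open>By leastness the predecessor \<open>x\<close> fails. The last premise leaves a violated
  lower bound as the only cause, and this bound is attained at the shift.\<close>

lemma not_lo_eq:
  assumes "1 \<le> k" "k \<le> M" "shift A k = Suc x" "Suc x \<notin> A \<or> \<not> hi k (Suc x)"
  obtains i where "i \<in> {1..k}" "L i = i + shift A k"
proof -
  have "\<not> lo k x" using shift_least[of k x A] assms by force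
  then show ?thesis using shift_props(1)[OF assms(1,2), of A] assms(3) that
    unfolding lo_def by force
qed

text \<open>A violated upper bound would, by leastness, come with an attained lower bound
  \<open>L i = i + shift A k\<close>, and the Hall inequalities starting at \<open>i\<close> exclude
  this.\<close>

lemma shift_hi:
  assumes k: "1 \<le> k" "k \<le> M"
  shows "hi k (shift A k)"
proof (cases "shift A k")
  case 0
  have "i \<le> R i" if "k \<le> i" "i \<le> M" for i
    using hall[of 1 i] L_ge_1[of 1] that k by auto
  then show ?thesis using 0 by (auto simp: hi_def)
next
  case (Suc x)
  show ?thesis
  proof (rule ccontr)
    assume no: "\<not> hi k (shift A k)"
    then obtain i where i: "i \<in> {1..k}" "L i = i + shift A k"
      using not_lo_eq[OF k Suc] Suc by auto
    have "j + shift A k \<le> R j" if "k \<le> j" "j \<le> M" for j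
      using hall[of i j] i that by auto
    then show False using no by (auto simp: hi_def)
  qed
qed

text \<open>Passing from \<open>Suc k\<close> to \<open>k\<close> drops a lower bound and adds an
  upper bound, so the shift of \<open>Suc k\<close> also qualifies for \<open>k\<close>.\<close>

lemma shift_Suc:
  assumes "1 \<le> k" "k < M"
  shows "shift A k \<le> shift A (Suc k)"
  using assms shift_props[of "Suc k" A] lo_antimono[of "Suc k" _ k] hi_antimono[of k _ "Suc k"]
  by (intro shift_least) auto

lemma shift_mono:
  assumes "i \<le> k" "1 \<le> i" "k \<le> M"
  shows "shift A i \<le> shift A k"
  using assms(1,3)
proof (induction k rule: dec_induct)
  case (step m)
  then show ?case using shift_Suc[of m A] assms(2) by simp
qed simp

text \<open>The lower bound at the first index of the cut and the upper bound at the last one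
  squeeze the shift to \<open>c\<close>, whatever \<open>A\<close> is. So a mixed column always
  separates the pure columns number \<open>c\<close> and \<open>c + 1\<close>.\<close>

lemma shift_cut:
  assumes "cut c"
  obtains k where "1 \<le> k" "k \<le> M" "shift A k = c"
proof -
  obtain i k where ik: "1 \<le> i" "i \<le> k" "k \<le> M" "L i = i + c" "R k = k + c"
    using assms by (auto simp: cut_def)
  have "c \<le> shift A i" using loD[OF shift_props(1)[of i A], of i] ik by simp
  moreover have "shift A i \<le> c" using hiD[OF shift_hi[of i A], of k] ik by simp
  ultimately show ?thesis using that[of i] ik by simp
qed

text \<open>Counterpart of \<open>mixed_then_pure1\<close> for the constructed positions; the last
  two premises say that a pure column with entry 1 comes next. Some upper bound from
  \<open>k\<close> on is attained, and one at a later index would be violated by the larger shift of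
  \<open>Suc k\<close>.\<close>

lemma shift_eq_R:
  assumes "1 \<le> k" "k \<le> M" "Suc (shift A k) \<in> A" "k < M \<Longrightarrow> shift A (Suc k) \<noteq> shift A k"
  shows "R k = k + shift A k"
proof -
  have "\<not> hi k (Suc (shift A k))" using shift_props(2)[OF assms(1,2), of A] assms(3) by blast
  then obtain i where i: "k \<le> i" "i \<le> M" "R i = i + shift A k"
    using shift_hi[OF assms(1,2), of A] by (force simp: hi_def)
  have "i = k"
  proof (rule ccontr)
    assume "i \<noteq> k"
    then have "i + shift A (Suc k) \<le> R i" "k < M"
      using hiD[OF shift_hi[of "Suc k" A], of i] i by simp_all
    then show False using i shift_Suc[OF assms(1), of A] assms(4) by simp
  qed
  then show ?thesis using i by simp
qed

lemma shift_eq_L: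
  assumes "1 \<le> k" "k \<le> M" "shift A k \<notin> A" "1 \<le> shift A k"
    "1 < k \<Longrightarrow> shift A (k - 1) \<noteq> shift A k"
  shows "L k = k + shift A k"
proof -
  obtain x where x: "shift A k = Suc x" using assms by (cases "shift A k") auto
  obtain i where i: "i \<in> {1..k}" "L i = i + shift A k"
    using not_lo_eq[OF assms(1,2) x] assms(3) x by auto
  have "i = k"
  proof (rule ccontr)
    assume "i \<noteq> k"
    then have k': "i \<le> k - 1" "1 \<le> k - 1" "k - 1 < M" "1 < k" using i assms by auto
    then have "L i \<le> i + shift A (k - 1)"
      using loD[OF shift_props(1)[of "k - 1" A], of i] i by simp
    then show False using i shift_Suc[of "k - 1" A] assms(5) k' by simp
  qed
  then show ?thesis using i by simp
qed

text \<open>The true count qualifies by \<open>lo_mixed\<close> and \<open>not_hi_mixed\<close>. If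
  the least \<open>x\<close> were smaller, the word would have a 2 at \<open>Suc x\<close> and a 1
  at the true count, hence a descent \<open>c\<close> between them and a cut at \<open>c\<close>.
  Either the lower bound of the cut exceeds \<open>x\<close>, or its first index is beyond the rank
  and its upper bound is below the true count.\<close>

lemma shift_ones:
  assumes h: "h \<in> nu_heights" and j: "j \<in> mixed h"
  shows "shift (ones h) (rank (mixed h) j) = rank ({1..n} - mixed h) j"
proof (rule antisym)
  let ?k = "rank (mixed h) j" and ?q = "rank ({1..n} - mixed h) j"
  show "shift (ones h) ?k \<le> ?q"
    using lo_mixed[OF h j] not_hi_mixed[OF h j] by (intro shift_least) auto
  show "?q \<le> shift (ones h) ?k"
  proof (rule ccontr)
    define x where "x = shift (ones h) ?k"
    assume "\<not> ?thesis"
    then have xq: "Suc x \<le> ?q" by (simp add: x_def)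
    note k = rank_mixed_bounds[OF h j]
    have x: "lo ?k x" "hi ?k (Suc x) \<Longrightarrow> Suc x \<notin> ones h"
      using shift_props[OF k, of "ones h"] by (auto simp: x_def)
    have "hi ?k (Suc x)" using hi_mixed[OF h j] xq by (force simp: hi_def)
    then have xA: "Suc x \<notin> ones h" by (rule x)
    obtain p where p: "?q = Suc p" using xq by (cases ?q) auto
    have "lo ?k p" using x(1) xq p by (force simp: lo_def)
    then have qA: "?q \<in> ones h" using not_lo_mixed[OF h j p] p by auto
    have "\<exists>c. Suc x \<le> c \<and> c < ?q \<and> c \<notin> ones h \<and> Suc c \<in> ones h"
    proof (rule ccontr)
      assume no: "\<not> ?thesis"
      have "c \<notin> ones h" if "c \<le> ?q" "Suc x \<le> c" for c
        using that(2,1)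
      proof (induction c rule: dec_induct)
        case base
        show ?case by (rule xA)
      next
        case (step m)
        then have "m < ?q" "m \<notin> ones h" by auto
        then show ?case using no step.hyps by blast
      qed
      then show False using qA xq by blast
    qed
    then obtain c where c: "Suc x \<le> c" "c < ?q" "c \<notin> ones h" "Suc c \<in> ones h" by blast
    then have "cut c" using ones_descent[OF h] by auto
    then obtain i i' where i: "1 \<le> i" "i \<le> i'" "i' \<le> M" "L i = i + c" "R i' = i' + c"
      by (auto simp: cut_def)
    show False
    proof (cases "i \<le> ?k")
      case True
      then show False using x(1) i c by (force simp: lo_def)
    next
      case False
      then show False using hiD[OF hi_mixed[OF h j], of i'] i c by simp
    qed
  qed
qed

lemma mixed_of_ones:
  assumes h: "h \<in> nu_heights"
  shows "mixed_of (ones h) = mixed h"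
proof -
  have *: "rank (mixed h) j + shift (ones h) (rank (mixed h) j) = j" if "j \<in> mixed h" for j
    using shift_ones[OF h that] rank_sum[OF h, of j] that by (auto simp: mixed_def)
  have "rank (mixed h) ` mixed h = {1..M}"
  proof
    show "rank (mixed h) ` mixed h \<subseteq> {1..M}" using rank_mixed_bounds[OF h] by auto
    show "{1..M} \<subseteq> rank (mixed h) ` mixed h"
      using rank_surj[of _ "mixed h" n] rank_mixed_n[OF h] by (metis atLeastAtMost_iff imageI subsetI)
  qed
  then have "mixed_of (ones h) = (\<lambda>k. k + shift (ones h) k) ` rank (mixed h) ` mixed h"
    by (simp add: mixed_of_def)
  also have "\<dots> = mixed h" using * by (force simp: image_image)
  finally show ?thesis .
qed

lemma height_of_ones:
  assumes h: "h \<in> nu_heights"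
  shows "height_of (ones h) = h"
proof
  fix j
  consider "j \<notin> {1..n}" | "j \<in> mixed h" | "j \<in> {1..n}" "j \<notin> mixed h" by blast
  then show "height_of (ones h) j = h j"
  proof cases
    case 1
    then show ?thesis using h by (auto simp: height_of_def nu_heights_def heights_def extensional_def)
  next
    case 2
    then show ?thesis using h mixed_subset[of h]
      by (auto simp: height_of_def mixed_of_ones[OF h] nu_heights_def)
  next
    case 3
    then show ?thesis using rank_in_ones[OF h, of j] heights_bounds[OF h, of j]
      by (auto simp: height_of_def mixed_of_ones[OF h] pure1_def mixed_def)
  qed
qed

section \<open>From a word back to a filling\<close>

context
  fixes A assumes A: "A \<in> descents"
begin

lemma position_less: "1 \<le> i \<Longrightarrow> i < k \<Longrightarrow> k \<le> M \<Longrightarrow> i + shift A i < k + shift A k"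
  using shift_mono[of i k A] by simp

lemma position_supp:
  assumes "1 \<le> k" "k \<le> M"
  shows "L k \<le> k + shift A k" "k + shift A k \<le> R k"
  using shift_props(1)[OF assms, of A] shift_hi[OF assms, of A] assms by (auto simp: lo_def hi_def)

lemma mixed_of_subset: "mixed_of A \<subseteq> {1..n}"
  using position_supp(2) R_le by (force simp: mixed_of_def)

lemma rank_mixed_of:
  assumes "1 \<le> k" "k \<le> M"
  shows "rank (mixed_of A) (k + shift A k) = k"
proof -
  have "mixed_of A \<inter> {1..k + shift A k} = (\<lambda>k. k + shift A k) ` {1..k}"
  proof
    show "mixed_of A \<inter> {1..k + shift A k} \<subseteq> (\<lambda>k. k + shift A k) ` {1..k}"
    proof
      fix j assume "j \<in> mixed_of A \<inter> {1..k + shift A k}"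
      then obtain i where i: "1 \<le> i" "i \<le> M" "j = i + shift A i" "j \<le> k + shift A k"
        by (auto simp: mixed_of_def)
      then have "i \<le> k" using position_less[of k i] assms by fastforce
      then show "j \<in> (\<lambda>k. k + shift A k) ` {1..k}" using i by auto
    qed
    show "(\<lambda>k. k + shift A k) ` {1..k} \<subseteq> mixed_of A \<inter> {1..k + shift A k}"
      using assms shift_mono[of _ k A] by (auto simp: mixed_of_def intro!: add_mono)
  qed
  moreover have "inj_on (\<lambda>k. k + shift A k) {1..k}"
  proof (rule linorder_inj_onI)
    fix x y assume "x < y" "x \<in> {1..k}" "y \<in> {1..k}"
    then show "x + shift A x \<noteq> y + shift A y" using position_less[of x y] assms by simp
  qed auto
  ultimately show ?thesis by (simp add: rank_def card_image)
qed

lemma rank_pure_of: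
  assumes "1 \<le> k" "k \<le> M"
  shows "rank ({1..n} - mixed_of A) (k + shift A k) = shift A k"
  using rank_complement[of "k + shift A k" n "mixed_of A"] rank_mixed_of[OF assms]
    position_supp[OF assms] R_le[OF assms] by simp

lemma card_mixed_of: "card (mixed_of A) = M"
proof -
  have "inj_on (\<lambda>k. k + shift A k) {1..M}"
  proof (rule linorder_inj_onI)
    fix x y assume "x < y" "x \<in> {1..M}" "y \<in> {1..M}"
    then show "x + shift A x \<noteq> y + shift A y" using position_less[of x y] by simp
  qed auto
  then show ?thesis by (simp add: mixed_of_def card_image)
qed

lemma height_of_mixed:
  assumes "1 \<le> k" "k \<le> M"
  shows "height_of A (k + shift A k) = nu k"
    and "s (k + shift A k) < nu k" "nu k < u (k + shift A k)"
proof -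
  have "k + shift A k \<in> mixed_of A" using assms by (auto simp: mixed_of_def)
  then show "height_of A (k + shift A k) = nu k"
    using mixed_of_subset rank_mixed_of[OF assms] by (auto simp: height_of_def)
  show "s (k + shift A k) < nu k" "nu k < u (k + shift A k)"
    using supp_iff[OF assms, of "k + shift A k"] position_supp[OF assms] by auto
qed

lemma mixed_height_of: "mixed (height_of A) = mixed_of A"
proof -
  have "j \<in> mixed (height_of A)" if "j \<in> mixed_of A" for j
  proof -
    from that obtain k where "1 \<le> k" "k \<le> M" "j = k + shift A k" by (rule mixed_ofE)
    then show ?thesis using height_of_mixed[of k] that mixed_of_subset by (auto simp: mixed_def)
  qed
  moreover have "j \<notin> mixed (height_of A)" if "j \<notin> mixed_of A" for j
    using that by (auto simp: mixed_def height_of_def)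
  ultimately show ?thesis by blast
qed

lemma height_of_mixed_bounds: "j \<in> mixed_of A \<Longrightarrow> s j \<le> height_of A j \<and> height_of A j \<le> u j"
  using mixed_height_of mixed_def[of "height_of A"] by (metis (no_types, lifting) mem_Collect_eq less_imp_le)

lemma height_of_pure:
  "j \<in> {1..n} \<Longrightarrow> j \<notin> mixed_of A \<Longrightarrow>
    height_of A j = (if rank ({1..n} - mixed_of A) j \<in> A then u j else s j)"
  by (simp add: height_of_def)

lemma height_of_bounds:
  assumes j: "j \<in> {1..n}"
  shows "s j \<le> height_of A j \<and> height_of A j \<le> u j"
proof (cases "j \<in> mixed_of A")
  case True
  then show ?thesis by (rule height_of_mixed_bounds)
next
  case False
  then show ?thesis using height_of_pure[OF j False] s_less_u[of j] j by auto
qed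

lemma height_of_mono:
  assumes j: "1 \<le> j" "j < n"
  shows "height_of A (Suc j) \<le> height_of A j"
proof -
  let ?J = "mixed_of A" and ?Z = "{1..n} - mixed_of A" and ?h = "height_of A"
  note bounds = height_of_bounds
  have jn: "j \<in> {1..n}" "Suc j \<in> {1..n}" using j by auto
  \<comment> \<open>A 1 on the left or a 2 on the right is harmless. Cases 4, 5 and 6 are the three
    neighbourhoods that can fail in general.\<close>
  consider "?h j = u j" | "?h (Suc j) = s (Suc j)"
    | "j \<in> ?J" "Suc j \<in> ?J"
    | "j \<in> ?J" "Suc j \<notin> ?J" "rank ?Z (Suc j) \<in> A"
    | "j \<notin> ?J" "Suc j \<in> ?J" "rank ?Z j \<notin> A"
    | "j \<notin> ?J" "Suc j \<notin> ?J" "rank ?Z (Suc j) \<in> A" "rank ?Z j \<notin> A"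
    using height_of_pure[OF jn(1)] height_of_pure[OF jn(2)] by metis
  then show ?thesis
  proof cases
    case 1
    then show ?thesis using bounds[OF jn(2)] u_anti[OF j] by simp
  next
    case 2
    then show ?thesis using bounds[OF jn(1)] s_anti[OF j] by simp
  next
    case 3
    from 3(1) obtain k where k: "1 \<le> k" "k \<le> M" "j = k + shift A k" by (rule mixed_ofE)
    from 3(2) obtain k' where k': "1 \<le> k'" "k' \<le> M" "Suc j = k' + shift A k'" by (rule mixed_ofE)
    have "k' = Suc k" using rank_mixed_of[OF k(1,2)] rank_mixed_of[OF k'(1,2)] 3
      unfolding k(3)[symmetric] k'(3)[symmetric] by (simp add: rank_Suc)
    then show ?thesis using height_of_mixed(1)[OF k(1,2)] height_of_mixed(1)[OF k'(1,2)]
        nu_anti[of k] k k' by simp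
  next
    case 4
    from 4(1) obtain k where k: "1 \<le> k" "k \<le> M" "j = k + shift A k" by (rule mixed_ofE)
    have "rank ?Z (Suc j) = Suc (shift A k)"
      using rank_pure_of[OF k(1,2)] 4 jn unfolding k(3)[symmetric] by (simp add: rank_Suc)
    moreover have "shift A (Suc k) \<noteq> shift A k" if "k < M"
    proof
      assume "shift A (Suc k) = shift A k"
      then have "Suc j \<in> ?J" using that k by (auto simp: mixed_of_def image_iff intro!: bexI[of _ "Suc k"])
      then show False using 4 by simp
    qed
    ultimately have "R k = j" using shift_eq_R[OF k(1,2), of A] 4 k by auto
    \<comment> \<open>Column \<open>Suc j\<close> is outside the support although
      \<open>s (Suc j) < nu k\<close>, so it must end at or above row \<open>nu k\<close>.\<close>
    then have "u (Suc j) \<le> nu k"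
      using supp_iff[OF k(1,2), of "Suc j"] height_of_mixed[OF k(1,2)] s_anti[OF j] jn k(3)
        position_supp(1)[OF k(1,2)] by auto
    then show ?thesis using height_of_mixed[OF k(1,2)] bounds[OF jn(2)] k(3) by simp
  next
    case 5
    from 5(2) obtain k where k: "1 \<le> k" "k \<le> M" "Suc j = k + shift A k" by (rule mixed_ofE)
    have c: "rank ?Z j = shift A k"
      using rank_pure_of[OF k(1,2)] 5 jn unfolding k(3)[symmetric] by (simp add: rank_Suc)
    have "1 \<le> rank ?Z j" using rank_less[of 0 j ?Z] 5 jn by simp
    moreover have "shift A (k - 1) \<noteq> shift A k" if "1 < k"
    proof
      assume "shift A (k - 1) = shift A k"
      then have "j \<in> ?J" using that k by (auto simp: mixed_of_def image_iff intro!: bexI[of _ "k - 1"])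
      then show False using 5 by simp
    qed
    ultimately have "L k = Suc j" using shift_eq_L[OF k(1,2), of A] 5 k c by auto
    then have "nu k \<le> s j"
      using supp_iff[OF k(1,2), of j] height_of_mixed[OF k(1,2)] u_anti[OF j] jn k(3)
        position_supp(2)[OF k(1,2)] by auto
    then show ?thesis using height_of_mixed[OF k(1,2)] bounds[OF jn(1)] k(3) by simp
  next
    case 6
    \<comment> \<open>A 2 directly before a 1 would be a descent, so there is a cut and a mixed
      column \<open>?p\<close> with exactly \<open>?c\<close> pure columns to its left. It would lie
      strictly between \<open>j\<close> and \<open>Suc j\<close>.\<close>
    let ?c = "rank ?Z j"
    have c: "rank ?Z (Suc j) = Suc ?c" using 6 jn by (simp add: rank_Suc)
    have "1 \<le> ?c" using rank_less[of 0 j ?Z] 6 jn by simp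
    then have "cut ?c" using A 6 c by (auto simp: descent_sets_def)
    then obtain k where k: "1 \<le> k" "k \<le> M" "shift A k = ?c" by (rule shift_cut)
    let ?p = "k + shift A k"
    have "k \<in> {1..M}" using k by simp
    then have p: "?p \<in> ?J" unfolding mixed_of_def by (rule imageI)
    have c': "rank ?Z ?p = ?c" using rank_pure_of[OF k(1,2)] k(3) by simp
    have "\<not> ?p < j" using rank_less[of ?p j ?Z] 6 jn p c' by auto
    moreover have "\<not> Suc j \<le> ?p" using rank_mono[of "Suc j" ?p ?Z] c c' by auto
    moreover have "?p \<noteq> j" using p 6 by auto
    ultimately show ?thesis by linarith
  qed
qed

lemma height_of_in_nu_heights: "height_of A \<in> nu_heights"
proof -
  have "height_of A \<in> extensional {1..n}" by (simp add: height_of_def)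
  moreover have "height_of A j = nu (rank (mixed_of A) j)" if "j \<in> mixed_of A" for j
    using that mixed_of_subset by (auto simp: height_of_def)
  ultimately show ?thesis
    unfolding nu_heights_def heights_def mem_Collect_eq mixed_height_of
    using card_mixed_of height_of_mono height_of_bounds by blast
qed

lemma ones_height_of: "ones (height_of A) = A"
proof -
  let ?Z = "{1..n} - mixed_of A"
  have pure: "pure1 (height_of A) = {j \<in> ?Z. rank ?Z j \<in> A}"
  proof -
    have "j \<in> ?Z" if "j \<in> pure1 (height_of A)" for j
      using pure1_not_mixed[OF that] mixed_height_of by simp
    moreover have "height_of A j = u j \<longleftrightarrow> rank ?Z j \<in> A" if "j \<in> ?Z" for j
      using height_of_pure[of j] that s_less_u[of j] by auto
    ultimately show ?thesis by (auto simp: pure1_def)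
  qed
  have "A \<subseteq> rank ?Z ` {j \<in> ?Z. rank ?Z j \<in> A}"
  proof
    fix c assume c: "c \<in> A"
    have "rank ?Z n = n - M"
      using rank_complement[of n n "mixed_of A"] rank_eq_card[OF mixed_of_subset] card_mixed_of by simp
    then have "1 \<le> c" "c \<le> rank ?Z n" using A c by (auto simp: descent_sets_def)
    then obtain j where "j \<in> ?Z" "rank ?Z j = c" by (rule rank_surj)
    then show "c \<in> rank ?Z ` {j \<in> ?Z. rank ?Z j \<in> A}" using c by blast
  qed
  then show ?thesis unfolding ones_def mixed_height_of pure by blast
qed

end

lemma sum_nu_heights:
  "(\<Sum>h\<in>nu_heights. f (card (pure1 h))) = (\<Sum>A\<in>descents. f (card A))"
  by (rule sum.reindex_bij_witness[of _ height_of ones])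
    (simp_all add: height_of_ones ones_in_descents ones_height_of height_of_in_nu_heights card_ones)

end

section \<open>12-rpps as height functions\<close>

lemma rpp12D:
  assumes "T \<in> rpp12 S"
  shows "(i, j) \<in> S \<Longrightarrow> (i, j') \<in> S \<Longrightarrow> j \<le> j' \<Longrightarrow> T (i, j) \<le> T (i, j')"
    and "(i, j) \<in> S \<Longrightarrow> (i', j) \<in> S \<Longrightarrow> i \<le> i' \<Longrightarrow> T (i, j) \<le> T (i', j)"
    and "c \<in> S \<Longrightarrow> T c = 1 \<or> T c = 2"
  using assms by (auto simp: rpp12_def)

context column_data begin

definition cells :: "cell set" where
  "cells = {(i, j). 1 \<le> j \<and> j \<le> n \<and> s j < i \<and> i \<le> u j}"

definition filling :: "(nat \<Rightarrow> nat) \<Rightarrow> cell \<Rightarrow> nat" where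
  "filling h = restrict (\<lambda>(i, j). if i \<le> h j then 1 else 2) cells"

definition heights_of :: "(cell \<Rightarrow> nat) \<Rightarrow> nat \<Rightarrow> nat" where
  "heights_of T = restrict (\<lambda>j. s j + card {i. (i, j) \<in> cells \<and> T (i, j) = 1}) {1..n}"

lemma heights_antimono: "h \<in> heights \<Longrightarrow> 1 \<le> i \<Longrightarrow> i \<le> j \<Longrightarrow> j \<le> n \<Longrightarrow> h j \<le> h i"
proof (induction j)
  case (Suc j)
  then have "i \<noteq> Suc j \<Longrightarrow> h (Suc j) \<le> h j" by (auto simp: heights_def)
  then show ?case using Suc by (cases "i = Suc j") auto
qed simp

text \<open>Columns increase weakly, so the 1s form an initial segment and counting them recovers
  its end.\<close>

lemma filling_eq_1:
  assumes T: "T \<in> rpp12 cells" and c: "(i, j) \<in> cells"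
  shows "T (i, j) = 1 \<longleftrightarrow> i \<le> heights_of T j"
proof -
  let ?D = "{i. (i, j) \<in> cells \<and> T (i, j) = 1}"
  define d where "d = card ?D"
  have "?D = {s j<..s j + d}"
    unfolding d_def
  proof (rule down_closed_eq_interval)
    show "?D \<subseteq> {s j<..u j}" by (auto simp: cells_def)
    fix k assume k: "s j < k" "Suc k \<in> ?D"
    then have kc: "(k, j) \<in> cells" "(Suc k, j) \<in> cells" by (auto simp: cells_def)
    then have "T (k, j) \<le> T (Suc k, j)" "T (k, j) = 1 \<or> T (k, j) = 2"
      using rpp12D[OF T] by auto
    then show "k \<in> ?D" using k kc by auto
  qed
  then have "i \<in> ?D \<longleftrightarrow> i \<in> {s j<..s j + d}" by (rule arg_cong)
  moreover have "heights_of T j = s j + d" using c by (simp add: heights_of_def cells_def d_def)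
  ultimately show ?thesis using c by (simp add: cells_def)
qed

lemma heights_of_in_heights:
  assumes T: "T \<in> rpp12 cells"
  shows "heights_of T \<in> heights"
proof -
  let ?h = "heights_of T"
  have le: "?h j \<le> u j" if "1 \<le> j" "j \<le> n" for j
  proof -
    have "card {i. (i, j) \<in> cells \<and> T (i, j) = 1} \<le> card {s j<..u j}"
      by (intro card_mono) (auto simp: cells_def)
    then show ?thesis using that s_less_u[OF that] by (simp add: heights_of_def)
  qed
  have ge: "s j \<le> ?h j" if "1 \<le> j" "j \<le> n" for j
    using that by (simp add: heights_of_def)
  have "?h (Suc j) \<le> ?h j" if j: "1 \<le> j" "j < n" for j
  proof (cases "?h (Suc j) \<le> s j")
    case True
    then show ?thesis using ge[of j] j by simp
  next
    case False
    \<comment> \<open>Column \<open>j\<close> also has a cell in row \<open>?i\<close>, and the 1 to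
      the right of it forces a 1 there.\<close>
    let ?i = "?h (Suc j)"
    have c: "(?i, j) \<in> cells" "(?i, Suc j) \<in> cells"
      using False j le[of "Suc j"] s_anti[OF j] u_anti[OF j] by (auto simp: cells_def)
    have "T (?i, Suc j) = 1" using filling_eq_1[OF T c(2)] by simp
    moreover have "T (?i, j) \<le> T (?i, Suc j)" "T (?i, j) = 1 \<or> T (?i, j) = 2"
      using rpp12D(1)[OF T c] rpp12D(3)[OF T c(1)] by auto
    ultimately have "T (?i, j) = 1" by auto
    then show ?thesis using filling_eq_1[OF T c(1)] by simp
  qed
  then show ?thesis using le ge by (auto simp: heights_def heights_of_def)
qed

lemma filling_in_rpp12:
  assumes h: "h \<in> heights"
  shows "filling h \<in> rpp12 cells"
proof -
  have "filling h (i, j) \<le> filling h (i, j')" if "(i, j) \<in> cells" "(i, j') \<in> cells" "j \<le> j'" for i j j'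
    using heights_antimono[OF h, of j j'] that by (auto simp: filling_def cells_def)
  then show ?thesis by (auto simp: rpp12_def filling_def)
qed

lemma filling_heights_of: "T \<in> rpp12 cells \<Longrightarrow> filling (heights_of T) = T"
proof
  fix c :: cell assume T: "T \<in> rpp12 cells"
  obtain i j where c: "c = (i, j)" by (cases c)
  show "filling (heights_of T) c = T c"
  proof (cases "c \<in> cells")
    case True
    then have "T c \<in> {1, 2}" using T by (auto simp: rpp12_def)
    then show ?thesis using True filling_eq_1[OF T, of i j] by (auto simp: c filling_def)
  next
    case False
    have "T \<in> extensional cells" using T by (simp add: rpp12_def PiE_def)
    from extensional_arb[OF this False] show ?thesis using False by (simp add: filling_def)
  qed
qed

lemma heights_of_filling: "h \<in> heights \<Longrightarrow> heights_of (filling h) = h"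
proof
  fix j assume h: "h \<in> heights"
  show "heights_of (filling h) j = h j"
  proof (cases "j \<in> {1..n}")
    case True
    then have b: "s j \<le> h j" "h j \<le> u j" using h by (auto simp: heights_def)
    then have "{i. (i, j) \<in> cells \<and> filling h (i, j) = 1} = {s j<..h j}"
      using True by (auto simp: cells_def filling_def split: if_splits)
    then show ?thesis using True b by (simp add: heights_of_def)
  next
    case False
    then show ?thesis using h by (auto simp: heights_of_def heights_def extensional_def)
  qed
qed

lemma sep_cells_filling: "sep_cells cells (filling h) = {(i, j). j \<in> mixed h \<and> i = h j}"
  by (auto simp: sep_cells_def cells_def filling_def mixed_def split: if_splits)

lemma seplist_filling: "seplist cells (filling h) = map h (sorted_list_of_set (mixed h))"
proof -
  have fin: "finite (mixed h)" by (simp add: mixed_def)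
  have "snd ` sep_cells cells (filling h) = mixed h"
    unfolding sep_cells_filling by force
  moreover have "(THE i. (i, j) \<in> sep_cells cells (filling h)) = h j" if "j \<in> mixed h" for j
    using that by (simp add: sep_cells_filling)
  ultimately show ?thesis using fin by (simp add: seplist_def)
qed

lemma ircont_filling:
  assumes h: "h \<in> heights"
  shows "ircont cells (filling h) 1 = card (mixed h) + card (pure1 h)"
    and "ircont cells (filling h) 2 = n - card (pure1 h)"
proof -
  have b: "s j \<le> h j \<and> h j \<le> u j \<and> s j < u j" if "1 \<le> j" "j \<le> n" for j
    using h that s_less_u[OF that] by (auto simp: heights_def)
  have "{j. \<exists>i. (i, j) \<in> cells \<and> filling h (i, j) = 1} = mixed h \<union> pure1 h"
  proof (intro set_eqI iffI)
    fix j assume "j \<in> mixed h \<union> pure1 h"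
    then have "(Suc (s j), j) \<in> cells" "Suc (s j) \<le> h j"
      using b[of j] by (auto simp: mixed_def pure1_def cells_def)
    then show "j \<in> {j. \<exists>i. (i, j) \<in> cells \<and> filling h (i, j) = 1}"
      by (auto simp: filling_def intro!: exI[of _ "Suc (s j)"])
  next
    fix j assume "j \<in> {j. \<exists>i. (i, j) \<in> cells \<and> filling h (i, j) = 1}"
    then show "j \<in> mixed h \<union> pure1 h"
      using b[of j] by (auto simp: filling_def cells_def mixed_def pure1_def split: if_splits)
  qed
  moreover have "card (mixed h \<union> pure1 h) = card (mixed h) + card (pure1 h)"
    by (rule card_Un_disjoint) (auto simp: mixed_def pure1_def)
  ultimately show "ircont cells (filling h) 1 = card (mixed h) + card (pure1 h)"
    by (simp add: ircont_def)
  have "{j. \<exists>i. (i, j) \<in> cells \<and> filling h (i, j) = 2} = {1..n} - pure1 h"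
  proof (intro set_eqI iffI)
    fix j assume j: "j \<in> {1..n} - pure1 h"
    then have "(u j, j) \<in> cells" "\<not> u j \<le> h j"
      using b[of j] by (auto simp: pure1_def cells_def)
    then show "j \<in> {j. \<exists>i. (i, j) \<in> cells \<and> filling h (i, j) = 2}"
      by (auto simp: filling_def intro!: exI[of _ "u j"])
  next
    fix j assume "j \<in> {j. \<exists>i. (i, j) \<in> cells \<and> filling h (i, j) = 2}"
    then show "j \<in> {1..n} - pure1 h"
      by (auto simp: filling_def cells_def pure1_def split: if_splits)
  qed
  moreover have "pure1 h \<subseteq> {1..n}" by (auto simp: pure1_def)
  ultimately show "ircont cells (filling h) 2 = n - card (pure1 h)"
    by (simp add: ircont_def card_Diff_subset finite_subset[of _ "{1..n}"])
qed

lemma sum_rpp12: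
  assumes xs: "length xs = M" "\<And>k. 1 \<le> k \<Longrightarrow> k \<le> M \<Longrightarrow> nu k = xs ! (k - 1)"
  shows "(\<Sum>T\<in>{T \<in> rpp12 cells. seplist cells T = xs}. f (ircont cells T 1) (ircont cells T 2)) =
    (\<Sum>h\<in>nu_heights. f (M + card (pure1 h)) (n - card (pure1 h)))"
proof (rule sum.reindex_bij_witness[of _ filling heights_of])
  have iff: "seplist cells (filling h) = xs \<longleftrightarrow> h \<in> nu_heights" if "h \<in> heights" for h
  proof -
    have sub: "mixed h \<subseteq> {1..n}" by (auto simp: mixed_def)
    have "xs ! (rank (mixed h) j - 1) = nu (rank (mixed h) j)" if "j \<in> mixed h" "card (mixed h) = M" for j
    proof -
      have "1 \<le> rank (mixed h) j" "rank (mixed h) j \<le> M"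
        using rank_less[of 0 j "mixed h"] rank_mono[of j n "mixed h"] rank_eq_card[OF sub] sub that
        by auto
      then show ?thesis using xs(2) by simp
    qed
    then show ?thesis
      unfolding seplist_filling map_sorted_list_of_set_eq_iff[OF sub] nu_heights_def
      using that xs(1) by auto
  qed
  fix T assume "T \<in> {T \<in> rpp12 cells. seplist cells T = xs}"
  then have T: "T \<in> rpp12 cells" "seplist cells T = xs" by auto
  note h = heights_of_in_heights[OF T(1)]
  show "filling (heights_of T) = T" using T by (simp add: filling_heights_of)
  then show hn: "heights_of T \<in> nu_heights" using iff[OF h] T by simp
  show "f (M + card (pure1 (heights_of T))) (n - card (pure1 (heights_of T))) =
      f (ircont cells T 1) (ircont cells T 2)"
    using ircont_filling[OF h] hn filling_heights_of[OF T(1)] by (simp add: nu_heights_def)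
next
  fix h assume hn: "h \<in> nu_heights"
  then have h: "h \<in> heights" by (simp add: nu_heights_def)
  show "heights_of (filling h) = h" using h by (rule heights_of_filling)
  have sub: "mixed h \<subseteq> {1..n}" by (auto simp: mixed_def)
  have "h j = xs ! (rank (mixed h) j - 1)" if "j \<in> mixed h" for j
    using hn that xs(2) rank_mixed_bounds[OF hn that] by (auto simp: nu_heights_def)
  then have "seplist cells (filling h) = xs"
    unfolding seplist_filling map_sorted_list_of_set_eq_iff[OF sub]
    using hn xs(1) by (auto simp: nu_heights_def)
  then show "filling h \<in> {T \<in> rpp12 cells. seplist cells T = xs}"
    using filling_in_rpp12[OF h] by simp
qed

text \<open>Each of the \<open>M\<close> mixed columns contributes \<open>x * y\<close>, a pure
  column a single variable.\<close>

lemma sum_rpp12_descents: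
  fixes x y :: "'a::comm_semiring_1"
  assumes "length xs = M" "\<And>k. 1 \<le> k \<Longrightarrow> k \<le> M \<Longrightarrow> nu k = xs ! (k - 1)"
  shows "(\<Sum>T\<in>{T \<in> rpp12 cells. seplist cells T = xs}.
      x ^ ircont cells T 1 * y ^ ircont cells T 2) =
    (x * y) ^ M * (\<Sum>A\<in>descents. x ^ card A * y ^ (n - M - card A))"
proof -
  have "(\<Sum>T\<in>{T \<in> rpp12 cells. seplist cells T = xs}.
      x ^ ircont cells T 1 * y ^ ircont cells T 2) =
    (\<Sum>h\<in>nu_heights. x ^ (M + card (pure1 h)) * y ^ (n - card (pure1 h)))"
    by (rule sum_rpp12[OF assms])
  also have "\<dots> = (\<Sum>A\<in>descents. x ^ (M + card A) * y ^ (n - card A))"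
    by (rule sum_nu_heights)
  also have "\<dots> = (\<Sum>A\<in>descents. (x * y) ^ M * (x ^ card A * y ^ (n - M - card A)))"
  proof (rule sum.cong[OF refl])
    fix A assume "A \<in> descents"
    then have "card A \<le> n - M" using card_mono[of "{1..n - M}" A] by (auto simp: descent_sets_def)
    then have "n - card A = M + (n - M - card A)" using M_le by simp
    then have "y ^ (n - card A) = y ^ M * y ^ (n - M - card A)" by (metis power_add)
    then show "x ^ (M + card A) * y ^ (n - card A) = (x * y) ^ M * (x ^ card A * y ^ (n - M - card A))"
      by (simp add: power_add power_mult_distrib ac_simps)
  qed
  finally show ?thesis by (simp add: sum_distrib_left)
qed

end

section \<open>Tight intervals and irreducible components\<close>

text \<open>Makes monotone predicates into index thresholds; the ends of supports, the blocks and
  the columns of a diagram are all compared in this way.\<close>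

lemma initial_segment:
  fixes Q :: "nat \<Rightarrow> bool"
  assumes "\<And>i k. 1 \<le> i \<Longrightarrow> i < k \<Longrightarrow> k \<le> m \<Longrightarrow> Q k \<Longrightarrow> Q i"
  obtains p where "p \<le> m" "\<And>k. 1 \<le> k \<Longrightarrow> k \<le> m \<Longrightarrow> Q k \<longleftrightarrow> k \<le> p"
proof -
  have "\<exists>p\<le>m. \<forall>k. 1 \<le> k \<and> k \<le> m \<longrightarrow> (Q k \<longleftrightarrow> k \<le> p)"
    using assms
  proof (induction m)
    case (Suc m)
    show ?case
    proof (cases "Q (Suc m)")
      case True
      then have "Q k" if "1 \<le> k" "k \<le> Suc m" for k
        using Suc.prems[of k "Suc m"] that by (cases "k = Suc m") auto
      then show ?thesis by (intro exI[of _ "Suc m"]) auto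
    next
      case False
      from Suc obtain p where p: "p \<le> m" "\<forall>k. 1 \<le> k \<and> k \<le> m \<longrightarrow> (Q k \<longleftrightarrow> k \<le> p)" by auto
      then show ?thesis using False by (intro exI[of _ p]) (auto simp: le_Suc_eq)
    qed
  qed simp
  then show ?thesis using that by blast
qed

lemma length_filter_conv_card':
  "length (filter Q xs) = card {k \<in> {1..length xs}. Q (xs ! (k - 1))}"
proof -
  have "{k \<in> {1..length xs}. Q (xs ! (k - 1))} = Suc ` {i. i < length xs \<and> Q (xs ! i)}"
  proof
    show "{k \<in> {1..length xs}. Q (xs ! (k - 1))} \<subseteq> Suc ` {i. i < length xs \<and> Q (xs ! i)}"
    proof
      fix k assume "k \<in> {k \<in> {1..length xs}. Q (xs ! (k - 1))}"
      then show "k \<in> Suc ` {i. i < length xs \<and> Q (xs ! i)}"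
        by (intro image_eqI[of _ _ "k - 1"]) auto
    qed
  qed auto
  then show ?thesis by (simp add: length_filter_conv_card card_image)
qed

lemma interlaced_less:
  assumes "interlaced lam r a b" "1 \<le> i" "i < k" "k \<le> r"
  shows "b i < a k"
  using assms(3,4)
proof (induction k)
  case (Suc k)
  have step: "b j < a (Suc j)" if "1 \<le> j" "j < r" for j
    using assms(1) that by (auto simp: interlaced_def)
  show ?case
  proof (cases "i = k")
    case True
    then show ?thesis using step[of k] Suc assms by auto
  next
    case False
    then have "b i < a k" "a k < b k" "b k < a (Suc k)"
      using Suc assms step[of k] by (auto simp: interlaced_def)
    then show ?thesis by linarith
  qed
qed simp

locale interval_family =
  fixes lam mu nu :: "nat list" and n M :: nat and L R :: "nat \<Rightarrow> nat"
  assumes n_eq: "part lam 1 = n" and M_eq: "length nu = M"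
    and supp_eq: "1 \<le> k \<Longrightarrow> k \<le> M \<Longrightarrow> supp lam mu (nu ! (k - 1)) = {int (L k)..int (R k)}"
    and LR: "1 \<le> k \<Longrightarrow> k \<le> M \<Longrightarrow> 1 \<le> L k \<and> L k \<le> R k \<and> R k \<le> n"
    and L_mono: "1 \<le> i \<Longrightarrow> i \<le> k \<Longrightarrow> k \<le> M \<Longrightarrow> L i \<le> L k"
    and R_mono: "1 \<le> i \<Longrightarrow> i \<le> k \<Longrightarrow> k \<le> M \<Longrightarrow> R i \<le> R k"
    and sub_inside_le: "a < b \<Longrightarrow> int (length (sub_inside lam mu nu a b)) \<le> b - a"
begin

section \<open>Counting supports in an interval; tight intervals\<close>

definition inside :: "int \<Rightarrow> int \<Rightarrow> nat set" where
  "inside a b = {k \<in> {1..M}. a \<le> int (L k) \<and> int (R k) < b}"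

definition tight :: "int \<Rightarrow> int \<Rightarrow> bool" where
  "tight a b \<longleftrightarrow> a < b \<and> int (card (inside a b)) = b - a"

lemma finite_inside [simp]: "finite (inside a b)"
  by (simp add: inside_def)

lemma length_sub_inside: "length (sub_inside lam mu nu a b) = card (inside a b)"
proof -
  have "supp lam mu (nu ! (k - 1)) \<subseteq> {a..<b} \<longleftrightarrow> a \<le> int (L k) \<and> int (R k) < b"
    if "1 \<le> k" "k \<le> M" for k
    unfolding supp_eq[OF that] using LR[OF that] by (simp add: atLeastAtMost_subseteq_atLeastLessThan_iff)
  then show ?thesis
    unfolding sub_inside_def length_filter_conv_card' inside_def M_eq
    by (intro arg_cong[of _ _ card]) auto
qed

lemma length_sub_meeting:
  assumes "a < b"
  shows "length (sub_meeting lam mu nu a b) = card {k \<in> {1..M}. int (L k) < b \<and> a \<le> int (R k)}"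
proof -
  have "supp lam mu (nu ! (k - 1)) \<inter> {a..<b} \<noteq> {} \<longleftrightarrow> int (L k) < b \<and> a \<le> int (R k)"
    if "1 \<le> k" "k \<le> M" for k
  proof -
    have "max a (int (L k)) \<in> {int (L k)..int (R k)} \<inter> {a..<b}" if "int (L k) < b" "a \<le> int (R k)"
      using that assms LR[OF \<open>1 \<le> k\<close> \<open>k \<le> M\<close>] by auto
    then show ?thesis unfolding supp_eq[OF that] by fastforce
  qed
  then show ?thesis
    unfolding sub_meeting_def length_filter_conv_card' M_eq
    by (intro arg_cong[of _ _ card]) auto
qed

lemma card_inside_le: "a \<le> b \<Longrightarrow> int (card (inside a b)) \<le> b - a"
proof (cases "a = b")
  case True
  then have "inside a b = {}" using LR by (force simp: inside_def)
  then show ?thesis using True by simp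
qed (use sub_inside_le[of a b] length_sub_inside in simp)

lemma interval_inside:
  assumes "1 \<le> i" "i \<le> k" "k \<le> M"
  shows "{i..k} \<subseteq> inside (int (L i)) (int (R k) + 1)"
proof
  fix j assume "j \<in> {i..k}"
  then show "j \<in> inside (int (L i)) (int (R k) + 1)"
    using assms L_mono[of i j] R_mono[of j k] by (auto simp: inside_def)
qed

text \<open>The entries \<open>i\<close> to \<open>k\<close> all have their supports between
  \<open>L i\<close> and \<open>R k\<close>, and representability bounds their number.\<close>

lemma hall:
  assumes "1 \<le> i" "i \<le> k" "k \<le> M"
  shows "L i + k \<le> R k + i"
proof -
  have le: "L i \<le> R k" using assms L_mono[of i k] LR[of k] by simp
  have "card {i..k} \<le> card (inside (int (L i)) (int (R k) + 1))"
    using interval_inside[OF assms] by (intro card_mono) auto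
  also have "int \<dots> \<le> int (R k) + 1 - int (L i)" using le by (intro card_inside_le) simp
  finally show ?thesis using assms le by simp
qed

lemma M_le: "M \<le> n"
  using hall[of 1 M] LR[of 1] LR[of M] by (cases "M = 0") auto

text \<open>Clipping to the columns 1 to \<open>n\<close> loses no support, so a tight interval that
  stuck out would contain more supports than its clipped part has columns.\<close>

lemma tight_bounds:
  assumes "tight a b"
  shows "1 \<le> a" "b \<le> int n + 1"
proof -
  let ?a = "max a 1" and ?b = "min b (int n + 1)"
  have eq: "inside a b = inside ?a ?b" using LR by (force simp: inside_def)
  have "?a \<le> ?b"
  proof (rule ccontr)
    assume "\<not> ?a \<le> ?b"
    then have "inside ?a ?b = {}" using LR by (force simp: inside_def)
    then have "card (inside a b) = 0" unfolding eq by simp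
    then show False using assms unfolding tight_def by linarith
  qed
  from card_inside_le[OF this, folded eq] have "b - a \<le> ?b - ?a" using assms by (simp add: tight_def)
  then show "1 \<le> a" "b \<le> int n + 1" by auto
qed

text \<open>Submodularity: the counts of union and intersection add up to at least the two given
  counts, and neither exceeds the length of its interval. Touching intervals, \<open>a' = b\<close>,
  are included.\<close>

lemma tight_union:
  assumes "tight a b" "tight a' b'" "a \<le> a'" "a' \<le> b" "b \<le> b'"
  shows "tight a b'"
proof -
  have "card (inside a b) + card (inside a' b') =
      card (inside a b \<union> inside a' b') + card (inside a b \<inter> inside a' b')"
    by (rule card_Un_Int) auto
  moreover have "card (inside a b \<union> inside a' b') \<le> card (inside a b')"
    using assms by (intro card_mono) (auto simp: inside_def)
  moreover have "inside a b \<inter> inside a' b' = inside a' b" using assms by (auto simp: inside_def)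
  then have "card (inside a b \<inter> inside a' b') = card (inside a' b)" by simp
  moreover have "int (card (inside a' b)) \<le> b - a'" using assms by (intro card_inside_le) simp
  moreover have "int (card (inside a b')) \<le> b' - a"
    using assms by (intro card_inside_le) (auto simp: tight_def)
  moreover have "a < b" "int (card (inside a b)) = b - a" "int (card (inside a' b')) = b' - a'"
    using assms by (auto simp: tight_def)
  ultimately have "int (card (inside a b')) = b' - a" by linarith
  then show ?thesis using \<open>a < b\<close> assms(5) by (simp add: tight_def)
qed

text \<open>A longest tight interval around \<open>c\<close> works: by \<open>tight_union\<close>,
  whatever overlaps or touches it and sticks out would make it longer.\<close>

lemma maximal_tight:
  assumes "tight x y" "c \<in> {x..<y}"
  obtains x' y' where "tight x' y'" "c \<in> {x'..<y'}"
    "\<And>p q. tight p q \<Longrightarrow> p \<le> y' \<Longrightarrow> x' \<le> q \<Longrightarrow> x' \<le> p \<and> q \<le> y'"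
proof -
  define Q where "Q = (\<lambda>(x, y). tight x y \<and> c \<in> {x..<y})"
  have "\<forall>z. Q z \<longrightarrow> (case z of (x, y) \<Rightarrow> nat (y - x)) < Suc n"
    using tight_bounds by (fastforce simp: Q_def)
  moreover have "Q (x, y)" using assms by (simp add: Q_def)
  ultimately obtain z where z: "Q z"
    "\<forall>w. Q w \<longrightarrow> (case w of (x, y) \<Rightarrow> nat (y - x)) \<le> (case z of (x, y) \<Rightarrow> nat (y - x))"
    using ex_has_greatest_nat[of Q "(x, y)" "\<lambda>(x, y). nat (y - x)" "Suc n"] by (metis less_imp_le)
  obtain x' y' where xy: "z = (x', y')" by (cases z)
  have t: "tight x' y'" "c \<in> {x'..<y'}" using z by (auto simp: Q_def xy)
  have len: "q - p \<le> y' - x'" if "tight p q" "c \<in> {p..<q}" for p q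
    using z(2)[rule_format, of "(p, q)"] that t by (auto simp: Q_def xy tight_def)
  have "x' \<le> p \<and> q \<le> y'" if pq: "tight p q" "p \<le> y'" "x' \<le> q" for p q
  proof (rule ccontr)
    assume "\<not> ?thesis"
    then consider "p < x'" "q \<le> y'" | "x' \<le> p" "y' < q" | "p < x'" "y' < q" by linarith
    then show False
    proof cases
      case 1
      then show False using len[of p y'] tight_union[OF pq(1) t(1)] t pq by auto
    next
      case 2
      then show False using len[of x' q] tight_union[OF t(1) pq(1)] t pq by auto
    next
      case 3
      then show False using len[of p q] t pq by auto
    qed
  qed
  then show ?thesis using that t by blast
qed

section \<open>The irreducible decomposition and its offsets\<close>

context
  fixes r a b assumes dec: "irreducible_decomposition lam mu nu r a b"
begin

lemma inter: "interlaced lam r a b"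
  using dec by (simp add: irreducible_decomposition_def tight_sequence_def)

lemma interD: "b 0 = 1" "1 \<le> a 1" "1 \<le> k \<Longrightarrow> k \<le> r \<Longrightarrow> a k < b k"
  "1 \<le> k \<Longrightarrow> k < r \<Longrightarrow> b k < a (Suc k)" "b r \<le> a (Suc r)" "a (Suc r) = int n + 1"
  using inter n_eq by (auto simp: interlaced_def)

lemma tight_block: "1 \<le> k \<Longrightarrow> k \<le> r \<Longrightarrow> tight (a k) (b k)"
  using dec interD(3)
  by (auto simp: irreducible_decomposition_def tight_sequence_def tight_def length_sub_inside)

text \<open>A tight interval that is maximal among those containing \<open>c\<close> contains every block that it
  touches, so it can replace these blocks in the sequence.\<close>

lemma tight_not_free:
  assumes "tight x0 y0" "c \<in> {x0..<y0}"
  shows "c \<notin> free_columns r a b"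
proof
  assume cfree: "c \<in> free_columns r a b"
  obtain x y where t: "tight x y" "c \<in> {x..<y}"
    and touch: "\<And>p q. tight p q \<Longrightarrow> p \<le> y \<Longrightarrow> x \<le> q \<Longrightarrow> x \<le> p \<and> q \<le> y"
    using maximal_tight[OF assms] by blast
  have xy: "x < y" "1 \<le> x" "y \<le> int n + 1" using t(1) tight_bounds[OF t(1)] by (auto simp: tight_def)
  have less: "b i < a k" if "1 \<le> i" "i < k" "k \<le> r" for i k
    using interlaced_less[OF inter that] .
  \<comment> \<open>Blocks up to \<open>p\<close> end strictly before \<open>x\<close>, blocks from
    \<open>Suc q\<close> on start strictly after \<open>y\<close>, and those in between are
    swallowed. Strictness keeps the gaps that \<open>interlaced\<close> requires.\<close>
  obtain p where p: "p \<le> r" "\<And>k. 1 \<le> k \<Longrightarrow> k \<le> r \<Longrightarrow> b k < x \<longleftrightarrow> k \<le> p"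
  proof (rule initial_segment[of r "\<lambda>k. b k < x"])
    fix i k assume "1 \<le> i" "i < k" "k \<le> r" "b k < x"
    then show "b i < x" using less[of i k] interD(3)[of k] by linarith
  qed blast
  obtain q where q: "q \<le> r" "\<And>k. 1 \<le> k \<Longrightarrow> k \<le> r \<Longrightarrow> a k \<le> y \<longleftrightarrow> k \<le> q"
  proof (rule initial_segment[of r "\<lambda>k. a k \<le> y"])
    fix i k assume "1 \<le> i" "i < k" "k \<le> r" "a k \<le> y"
    then show "a i \<le> y" using less[of i k] interD(3)[of i] by linarith
  qed blast
  have pq: "p \<le> q"
  proof (cases "p = 0")
    case False
    then have "b p < x" "a p < b p" using p interD(3)[of p] by auto
    then show ?thesis using q(2)[of p] p(1) False xy by auto
  qed simp
  have within: "x \<le> a k \<and> b k \<le> y" if "p < k" "k \<le> q" for k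
    using touch[OF tight_block[of k]] p(2)[of k] q(1) q(2)[of k] that by auto
  \<comment> \<open>The exceptions \<open>p = 0\<close> here and \<open>q = r\<close> below are the
    outer ends, where \<open>interlaced\<close> allows equality.\<close>
  have bp: "b p < x \<or> p = 0" using p(1) p(2)[of p] by (cases "p = 0") auto
  have bq: "b q \<le> y"
    using within[of q] bp pq interD(1) xy by (cases "p = q") auto
  have aq: "y < a (Suc q) \<or> q = r" using q(1) q(2)[of "Suc q"] by (cases "q = r") auto
  have xa: "x \<le> a (Suc p)"
    using within[of "Suc p"] aq pq interD(6) xy by (cases "p = q") auto
  \<comment> \<open>The blocks \<open>Suc p\<close> to \<open>q\<close>, possibly none, give way to
    the single block from \<open>x\<close> to \<open>y\<close>; \<open>f\<close> yields the old
    index of a later block.\<close>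
  define r' where "r' = Suc p + (r - q)"
  define f where "f = (\<lambda>k. k - Suc p + q)"
  define a' where "a' = (\<lambda>k. if k \<le> p then a k else if k = Suc p then x else a (f k))"
  define b' where "b' = (\<lambda>k. if k \<le> p then b k else if k = Suc p then y else b (f k))"
  have f: "Suc q \<le> f k" "f k \<le> r" "f (Suc k) = Suc (f k)" if "Suc p < k" "k \<le> r'" for k
    using that q(1) by (auto simp: f_def r'_def)
  have f0: "f (Suc (Suc p)) = Suc q" "f (Suc r') = Suc r" using q(1) by (auto simp: f_def r'_def)
  have "interlaced lam r' a' b'"
    unfolding interlaced_def
  proof (intro conjI ballI)
    show "b' 0 = 1" "b' 0 \<le> a' 1" using interD(1,2) xy by (auto simp: a'_def b'_def)
    show "a' k < b' k" if "k \<in> {1..r'}" for k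
    proof -
      consider "k \<le> p" | "k = Suc p" | "Suc p < k" by linarith
      then show ?thesis
      proof cases
        case 3
        then show ?thesis using f[of k] that interD(3)[of "f k"] by (auto simp: a'_def b'_def)
      qed (use that interD(3)[of k] p(1) xy in \<open>auto simp: a'_def b'_def\<close>)
    qed
    show "b' k < a' (k + 1)" if "k \<in> {1..<r'}" for k
    proof -
      consider "k < p" | "k = p" | "k = Suc p" | "Suc p < k" by linarith
      then show ?thesis
      proof cases
        case 3
        then have "q < r" using that by (auto simp: r'_def)
        then show ?thesis using 3 aq f0 by (auto simp: a'_def b'_def)
      next
        case 4
        then show ?thesis using f[of k] f[of "Suc k"] that interD(4)[of "f k"]
          by (auto simp: a'_def b'_def)
      qed (use that interD(4)[of k] p(1) bp in \<open>auto simp: a'_def b'_def\<close>)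
    qed
    show "b' r' \<le> a' (r' + 1)"
    proof (cases "q = r")
      case True
      then show ?thesis using interD(6) xy f0 by (auto simp: a'_def b'_def r'_def)
    next
      case False
      then have "f r' = r" "Suc p < r'" using q(1) by (auto simp: f_def r'_def)
      then show ?thesis using interD(5) f0 by (auto simp: a'_def b'_def)
    qed
    show "a' (r' + 1) = int (part lam 1) + 1"
      using interD(6) f0 n_eq by (auto simp: a'_def r'_def)
  qed
  moreover have "tight (a' k) (b' k)" if "k \<in> {1..r'}" for k
  proof -
    consider "k \<le> p" | "k = Suc p" | "Suc p < k" by linarith
    then show ?thesis
    proof cases
      case 3
      then show ?thesis using f[of k] that tight_block[of "f k"] by (auto simp: a'_def b'_def)
    qed (use that tight_block[of k] p(1) t(1) in \<open>auto simp: a'_def b'_def\<close>)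
  qed
  ultimately have "tight_sequence lam mu nu r' a' b'"
    by (auto simp: tight_sequence_def tight_def length_sub_inside)
  moreover have "j \<in> free_columns r a b \<and> j \<noteq> c" if j: "j \<in> free_columns r' a' b'" for j
  proof -
    obtain k where k: "k \<le> r'" "b' k \<le> j" "j < a' (Suc k)"
      using j by (auto simp: free_columns_def)
    have free: ?thesis if "m \<le> r" "b m \<le> j" "j < a (Suc m)" "j \<noteq> c" for m
      using that by (auto simp: free_columns_def)
    consider "k < p" | "k = p" | "k = Suc p" | "Suc p < k" by linarith
    then show ?thesis
    proof cases
      case 1
      then have "a (Suc k) < b (Suc k)" "b (Suc k) < x" using interD(3)[of "Suc k"] p by auto
      then show ?thesis using free[of k] 1 k p(1) t(2) by (auto simp: a'_def b'_def)
    next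
      case 2
      then show ?thesis using free[of p] k p(1) t(2) xa by (auto simp: a'_def b'_def)
    next
      case 3
      then show ?thesis using free[of q] k q(1) t(2) bq f0 by (auto simp: a'_def b'_def)
    next
      case 4
      note fk = f[OF 4 k(1)]
      have "y < a (f k)" using q(2)[of "f k"] fk by auto
      then show ?thesis using free[of "f k"] 4 k fk t(2) interD(3)[of "f k"]
        by (auto simp: a'_def b'_def)
    qed
  qed
  then have "free_columns r' a' b' \<subset> free_columns r a b" using cfree by blast
  ultimately show False using dec by (auto simp: irreducible_decomposition_def)
qed

lemma not_free_in_block:
  assumes "1 \<le> c" "c \<le> int n" "c \<notin> free_columns r a b"
  obtains k where "1 \<le> k" "k \<le> r" "a k \<le> c" "c < b k"
proof -
  obtain p where p: "p \<le> r" "\<And>k. 1 \<le> k \<Longrightarrow> k \<le> r \<Longrightarrow> b k \<le> c \<longleftrightarrow> k \<le> p"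
  proof (rule initial_segment[of r "\<lambda>k. b k \<le> c"])
    fix i k assume "1 \<le> i" "i < k" "k \<le> r" "b k \<le> c"
    then show "b i \<le> c" using interlaced_less[OF inter, of i k] interD(3)[of k] by linarith
  qed blast
  have "b p \<le> c" using p(1) p(2)[of p] interD(1) assms(1) by (cases "p = 0") auto
  then have "a (Suc p) \<le> c" using assms(3) p(1) by (force simp: free_columns_def)
  then have "p \<noteq> r" using interD(6) assms(2) by auto
  then show ?thesis using that[of "Suc p"] p(1) p(2)[of "Suc p"] \<open>a (Suc p) \<le> c\<close> by auto
qed

definition left_count :: "int \<Rightarrow> nat" where
  "left_count x = card {i \<in> {1..M}. int (L i) < x}"

lemma left_count:
  "left_count x \<le> M"
  "1 \<le> i \<Longrightarrow> i \<le> M \<Longrightarrow> int (L i) < x \<longleftrightarrow> i \<le> left_count x"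
proof -
  obtain p where p: "p \<le> M" "\<And>k. 1 \<le> k \<Longrightarrow> k \<le> M \<Longrightarrow> int (L k) < x \<longleftrightarrow> k \<le> p"
  proof (rule initial_segment[of M "\<lambda>k. int (L k) < x"])
    fix i k assume "1 \<le> i" "i < k" "k \<le> M" "int (L k) < x"
    then show "int (L i) < x" using L_mono[of i k] by linarith
  qed blast
  have "{i \<in> {1..M}. int (L i) < x} = {1..p}" using p by auto
  then have "left_count x = p" by (simp add: left_count_def)
  then show "left_count x \<le> M" "1 \<le> i \<Longrightarrow> i \<le> M \<Longrightarrow> int (L i) < x \<longleftrightarrow> i \<le> left_count x"
    using p by auto
qed

lemma left_count_mono: "x \<le> y \<Longrightarrow> left_count x \<le> left_count y"
  unfolding left_count_def by (intro card_mono) auto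

text \<open>The indices inside a tight interval are consecutive and as many as its columns. The Hall
  inequality between the first and the last of them forces both ends of the interval to be
  attained.\<close>

lemma tight_indices:
  assumes "tight x y"
  obtains m where "m \<le> M" "int m = int (left_count x) + (y - x)"
    "int (L (Suc (left_count x))) = x" "int (R m) = y - 1"
    "\<And>i. 1 \<le> i \<Longrightarrow> i \<le> M \<Longrightarrow> int (R i) < y \<longleftrightarrow> i \<le> m"
proof -
  let ?l = "left_count x"
  obtain p where p: "p \<le> M" "\<And>k. 1 \<le> k \<Longrightarrow> k \<le> M \<Longrightarrow> int (R k) < y \<longleftrightarrow> k \<le> p"
  proof (rule initial_segment[of M "\<lambda>k. int (R k) < y"])
    fix i k assume "1 \<le> i" "i < k" "k \<le> M" "int (R k) < y"
    then show "int (R i) < y" using R_mono[of i k] by linarith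
  qed blast
  have "inside x y = {Suc ?l..p}"
  proof (intro set_eqI)
    fix i show "i \<in> inside x y \<longleftrightarrow> i \<in> {Suc ?l..p}"
      using left_count(2)[of i x] p(1) p(2)[of i] by (auto simp: inside_def)
  qed
  then have pl: "?l < p" "int p = int ?l + (y - x)" using assms by (auto simp: tight_def)
  have "x \<le> int (L (Suc ?l))" using left_count(2)[of "Suc ?l" x] pl p by auto
  moreover have "int (R p) < y" using p(1) p(2)[of p] pl by auto
  moreover have "L (Suc ?l) + p \<le> R p + Suc ?l" using hall[of "Suc ?l" p] pl p by auto
  ultimately have "int (L (Suc ?l)) = x" "int (R p) = y - 1" using pl by linarith+
  then show ?thesis using that p pl by blast
qed

text \<open>The number of pure columns left of the block \<open>{a k..<b k}\<close>, the same for every 12-rpp.\<close>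

definition offset :: "nat \<Rightarrow> nat" where
  "offset k = (if k = 0 then 0 else nat (a k - 1 - int (left_count (a k))))"

text \<open>The equations for \<open>L\<close> and \<open>R\<close> say that every block produces a
  cut at its offset.\<close>

lemma block_indices:
  assumes "1 \<le> k" "k \<le> r"
  obtains m where "left_count (a k) < m" "m \<le> M" "int m = int (left_count (a k)) + (b k - a k)"
    "a k = 1 + int (left_count (a k)) + int (offset k)"
    "L (Suc (left_count (a k))) = Suc (left_count (a k)) + offset k" "R m = m + offset k"
    "\<And>i. 1 \<le> i \<Longrightarrow> i \<le> M \<Longrightarrow> int (R i) < b k \<longleftrightarrow> i \<le> m"
proof -
  let ?l = "left_count (a k)"
  obtain m where m: "m \<le> M" "int m = int ?l + (b k - a k)"
    "int (L (Suc ?l)) = a k" "int (R m) = b k - 1"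
    "\<And>i. 1 \<le> i \<Longrightarrow> i \<le> M \<Longrightarrow> int (R i) < b k \<longleftrightarrow> i \<le> m"
    using tight_indices[OF tight_block[OF assms]] by metis
  have lm: "?l < m" using m interD(3)[OF assms] by simp
  \<comment> \<open>This rules out truncation by \<open>nat\<close> in
    \<open>offset\<close>.\<close>
  then have "L 1 + m \<le> R m + 1" "1 \<le> L 1" using hall[of 1 m] LR[of 1] m by auto
  then have eq: "a k = 1 + int ?l + int (offset k)" using m assms by (simp add: offset_def)
  then have "L (Suc ?l) = Suc ?l + offset k" "R m = m + offset k" using m by linarith+
  then show ?thesis using that m lm eq by blast
qed

lemma left_count_end: "left_count (a (Suc r)) = M"
proof -
  have "{i \<in> {1..M}. int (L i) < a (Suc r)} = {1..M}"
    using LR interD(6) by force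
  then show ?thesis by (simp add: left_count_def)
qed

lemma offset_end: "offset (Suc r) = n - M"
  using left_count_end interD(6) by (simp add: offset_def)

lemma offset_0: "offset 0 = 0"
  by (simp add: offset_def)

lemma a_mono: "1 \<le> k \<Longrightarrow> k \<le> r \<Longrightarrow> a k \<le> a (Suc k)"
  using interD(3)[of k] interD(4)[of k] interD(5) by (cases "k = r") auto

text \<open>For positive \<open>k\<close> this is the Hall inequality from the first entry inside
  block \<open>k\<close> to the last one inside block \<open>Suc k\<close>, or to the entry
  \<open>M\<close> if \<open>k = r\<close>.\<close>

lemma offset_mono: "k \<le> r \<Longrightarrow> offset k \<le> offset (Suc k)"
proof -
  assume kr: "k \<le> r"
  show ?thesis
  proof (cases "k = 0")
    case False
    then obtain m where m: "left_count (a k) < m" "m \<le> M"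
      "L (Suc (left_count (a k))) = Suc (left_count (a k)) + offset k"
      using block_indices[of k] kr by (metis One_nat_def Suc_leI neq0_conv)
    show ?thesis
    proof (cases "k = r")
      case True
      have "L (Suc (left_count (a k))) + M \<le> n + Suc (left_count (a k))"
        using hall[of "Suc (left_count (a k))" M] LR[of M] m by auto
      then show ?thesis using True m offset_end by simp
    next
      case False
      then obtain m' where m': "left_count (a (Suc k)) < m'" "m' \<le> M" "R m' = m' + offset (Suc k)"
        using block_indices[of "Suc k"] kr by (metis Suc_leI le_SucI le_neq_implies_less le_add1 plus_1_eq_Suc)
      have "left_count (a k) \<le> left_count (a (Suc k))"
        using a_mono[of k] \<open>k \<noteq> 0\<close> kr by (intro left_count_mono) auto
      then show ?thesis using hall[of "Suc (left_count (a k))" m'] m m' by simp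
    qed
  qed (simp add: offset_0)
qed

text \<open>A cut spans a tight interval, which starts in some block by
  \<open>tight_not_free\<close>; Hall inequalities between the ends of the two intervals show that
  the offset of this block is \<open>c\<close>. The value 0 is excluded because
  \<open>offset 0\<close> is 0 even without a cut there.\<close>

lemma cut_iff:
  assumes "1 \<le> c"
  shows "(\<exists>i k. 1 \<le> i \<and> i \<le> k \<and> k \<le> M \<and> L i = i + c \<and> R k = k + c) \<longleftrightarrow> c \<in> offset ` {..<Suc r}"
proof
  assume "c \<in> offset ` {..<Suc r}"
  then obtain k where k: "k \<le> r" "c = offset k"
    by (metis imageE lessThan_iff less_Suc_eq_le)
  then have "1 \<le> k" using assms offset_0 by (cases k) auto
  from block_indices[OF this k(1)] obtain m where "left_count (a k) < m" "m \<le> M"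
    "L (Suc (left_count (a k))) = Suc (left_count (a k)) + c" "R m = m + c" using k(2) by metis
  then show "\<exists>i k. 1 \<le> i \<and> i \<le> k \<and> k \<le> M \<and> L i = i + c \<and> R k = k + c"
    by (intro exI[of _ "Suc (left_count (a k))"] exI[of _ m]) auto
next
  assume "\<exists>i k. 1 \<le> i \<and> i \<le> k \<and> k \<le> M \<and> L i = i + c \<and> R k = k + c"
  then obtain i k where ik: "1 \<le> i" "i \<le> k" "k \<le> M" "L i = i + c" "R k = k + c" by blast
  have "card {i..k} \<le> card (inside (int (L i)) (int (R k) + 1))"
    using interval_inside[OF ik(1-3)] by (intro card_mono) auto
  moreover have "int (card (inside (int (L i)) (int (R k) + 1))) \<le> int (R k) + 1 - int (L i)"
    using ik by (intro card_inside_le) simp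
  ultimately have "tight (int (L i)) (int (R k) + 1)" using ik by (auto simp: tight_def)
  then have "int (L i) \<notin> free_columns r a b" by (rule tight_not_free) (use ik in auto)
  moreover have "1 \<le> L i" "L i \<le> n" using LR[of i] ik by auto
  ultimately obtain m where m: "1 \<le> m" "m \<le> r" "a m \<le> int (L i)" "int (L i) < b m"
    using not_free_in_block[of "int (L i)"] by auto
  let ?l = "left_count (a m)"
  obtain e where e: "?l < e" "e \<le> M" "int e = int ?l + (b m - a m)"
    "a m = 1 + int ?l + int (offset m)" "L (Suc ?l) = Suc ?l + offset m" "R e = e + offset m"
    using block_indices[OF m(1,2)] by metis
  have li: "Suc ?l \<le> i" using left_count(2)[of i "a m"] ik m by auto
  then have 1: "offset m \<le> c" using hall[of "Suc ?l" k] ik e by simp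
  then have "i \<le> e" using m(4) e ik by linarith
  then have "c \<le> offset m" using hall[of i e] ik e by simp
  then show "c \<in> offset ` {..<Suc r}" using 1 m(2) by (intro image_eqI[of _ _ m]) auto
qed

text \<open>If \<open>m\<close> supports end before \<open>b k\<close> and \<open>?l\<close>
  supports begin before \<open>a (Suc k)\<close>, the component has the indices \<open>Suc m\<close>
  to \<open>?l\<close>. Removing that many columns from the free interval leaves the pure columns
  gained between the two offsets.\<close>

lemma component_degree_eq:
  assumes "k \<le> r"
  shows "nat (component_degree lam mu nu a b k) = offset (Suc k) - offset k"
proof -
  let ?l = "left_count (a (Suc k))"
  have oS: "a (Suc k) = 1 + int ?l + int (offset (Suc k))"
  proof (cases "k = r")
    case True
    then show ?thesis using left_count_end offset_end interD(6) M_le by simp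
  next
    case False
    then show ?thesis using block_indices[of "Suc k"] assms by (metis Suc_leI le_add1 le_neq_implies_less plus_1_eq_Suc)
  qed
  have "\<exists>m. m \<le> ?l \<and> b k = 1 + int m + int (offset k) \<and>
    (\<forall>i. 1 \<le> i \<and> i \<le> M \<longrightarrow> (int (R i) < b k \<longleftrightarrow> i \<le> m))"
  proof (cases "k = 0")
    case True
    then show ?thesis using interD(1) LR by (intro exI[of _ 0]) (auto simp: offset_0, force)
  next
    case False
    then obtain m where m: "left_count (a k) < m" "m \<le> M" "int m = int (left_count (a k)) + (b k - a k)"
      "a k = 1 + int (left_count (a k)) + int (offset k)"
      "\<And>i. 1 \<le> i \<Longrightarrow> i \<le> M \<Longrightarrow> int (R i) < b k \<longleftrightarrow> i \<le> m"
      using block_indices[of k] assms by (metis One_nat_def Suc_leI neq0_conv)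
    have "b k \<le> a (Suc k)" using False assms interD(4)[of k] interD(5) by (cases "k = r") auto
    moreover have "L m \<le> R m" "int (R m) < b k" using LR[of m] m(1,2) m(5)[of m] by auto
    ultimately have "int (L m) < a (Suc k)" by linarith
    then have "m \<le> ?l" using left_count(2)[of m "a (Suc k)"] m by auto
    then show ?thesis using m by (intro exI[of _ m]) auto
  qed
  then obtain m where m: "m \<le> ?l" "b k = 1 + int m + int (offset k)"
    "\<And>i. 1 \<le> i \<Longrightarrow> i \<le> M \<Longrightarrow> int (R i) < b k \<longleftrightarrow> i \<le> m" by blast
  have "length (sub_meeting lam mu nu (b k) (a (Suc k))) = ?l - m"
  proof (cases "b k < a (Suc k)")
    case True
    have "{i \<in> {1..M}. int (L i) < a (Suc k) \<and> b k \<le> int (R i)} = {Suc m..?l}"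
    proof (intro set_eqI)
      fix i show "i \<in> {i \<in> {1..M}. int (L i) < a (Suc k) \<and> b k \<le> int (R i)} \<longleftrightarrow> i \<in> {Suc m..?l}"
        using left_count(1)[of "a (Suc k)"] left_count(2)[of i "a (Suc k)"] m(3)[of i] by force
    qed
    then show ?thesis by (simp add: length_sub_meeting[OF True])
  next
    case False
    \<comment> \<open>An empty free interval, possible at the outer ends only: the component is
      empty, and monotonicity of the offsets gives \<open>?l = m\<close>.\<close>
    then have "?l + offset (Suc k) \<le> m + offset k" using m oS by simp
    then have "?l = m" using offset_mono[OF assms] m by simp
    then show ?thesis using False by (simp add: sub_meeting_def)
  qed
  then show ?thesis using m oS offset_mono[OF assms]
    by (simp add: component_degree_def irreducible_component_def)
qed

end

end

section \<open>Skew shapes\<close>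

text \<open>For \<open>j \<ge> 1\<close> this is the \<open>j\<close>-th part of the conjugate
  partition.\<close>

definition column_length :: "nat list \<Rightarrow> nat \<Rightarrow> nat" where
  "column_length p j = card {i. 1 \<le> i \<and> j \<le> part p i}"

lemma part_antimono:
  assumes "is_partition p" "1 \<le> i" "i \<le> k"
  shows "part p k \<le> part p i"
  using assms sorted_wrt_nth_less[of "(\<ge>)" p "i - 1" "k - 1"]
  by (cases "i = k") (auto simp: part_def is_partition_def)

lemma part_ge_iff:
  assumes p: "is_partition p" and "1 \<le> i" "1 \<le> j"
  shows "j \<le> part p i \<longleftrightarrow> i \<le> column_length p j"
proof -
  obtain q where q: "q \<le> length p" "\<And>k. 1 \<le> k \<Longrightarrow> k \<le> length p \<Longrightarrow> j \<le> part p k \<longleftrightarrow> k \<le> q"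
  proof (rule initial_segment[of "length p" "\<lambda>k. j \<le> part p k"])
    fix i k assume "1 \<le> i" "i < k" "k \<le> length p" "j \<le> part p k"
    then show "j \<le> part p i" using part_antimono[OF p, of i k] by simp
  qed blast
  have iff: "j \<le> part p k \<longleftrightarrow> k \<le> q" if "1 \<le> k" for k
    using q that assms(3) by (cases "k \<le> length p") (auto simp: part_def)
  then have "{i. 1 \<le> i \<and> j \<le> part p i} = {1..q}" by auto
  then have "column_length p j = q" by (simp add: column_length_def)
  then show ?thesis using iff assms(2) by simp
qed

lemma column_length_antimono:
  assumes p: "is_partition p" and "1 \<le> i" "i \<le> j"
  shows "column_length p j \<le> column_length p i"
proof (cases "column_length p j = 0")
  case False
  then show ?thesis
    using part_ge_iff[OF p, of "column_length p j" j] part_ge_iff[OF p, of "column_length p j" i] assms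
    by auto
qed simp

lemma skew_iff:
  assumes "is_partition lam" "is_partition mu"
  shows "(i, j) \<in> skew lam mu \<longleftrightarrow> 1 \<le> j \<and> column_length mu j < i \<and> i \<le> column_length lam j"
  using part_ge_iff[OF assms(1), of i j] part_ge_iff[OF assms(2), of i j]
  by (auto simp: skew_def diagram_def)

text \<open>A path between the two columns has to cross from \<open>j\<close> to
  \<open>Suc j\<close> in a row that both contain; without such a row it never leaves the columns up
  to \<open>j\<close>.\<close>

lemma connected_cells_overlap:
  assumes lam: "is_partition lam" and mu: "is_partition mu"
    and conn: "connected_cells (skew lam mu)"
    and c: "(i, j) \<in> skew lam mu" "(i', Suc j) \<in> skew lam mu"
  shows "column_length mu j < column_length lam (Suc j)"
proof (rule ccontr)
  assume no: "\<not> ?thesis"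
  let ?E = "{(v, w). v \<in> skew lam mu \<and> w \<in> skew lam mu \<and> adjacent v w}"
  have "((i, j), (i', Suc j)) \<in> ?E\<^sup>*" using conn c by (auto simp: connected_cells_def)
  then have "snd (i', Suc j) \<le> j"
  proof (induction rule: rtrancl_induct)
    case (step v w)
    obtain v1 v2 w1 w2 where vw: "v = (v1, v2)" "w = (w1, w2)" by (cases v, cases w)
    have "\<not> (v2 = j \<and> w2 = Suc j \<and> w1 = v1)"
      using step.hyps(2) no skew_iff[OF lam mu] by (auto simp: vw)
    then show ?case using step by (auto simp: vw adjacent_def)
  qed simp
  then show False by simp
qed

theorem corollary7p7:
  fixes lam mu nu :: "nat list" and r :: nat and a b :: "nat \<Rightarrow> int"
  assumes "is_skew_partition lam mu"
    and "connected_cells (skew lam mu)"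
    and "no_empty_columns lam mu"
    and "representable lam mu nu"
    and "irreducible_decomposition lam mu nu r a b"
  shows "(\<Sum>T\<in>RPP12 lam mu nu. x_power (ircont (skew lam mu) T) :: 'k::comm_ring_1 polys) =
    (X 1 * X 2) ^ length nu * (\<Prod>k\<in>{0..r}. P (nat (component_degree lam mu nu a b k)))"
proof -
  have lam: "is_partition lam" and mu: "is_partition mu"
    using assms(1) by (auto simp: is_skew_partition_def)
  define n M where "n = part lam 1" and "M = length nu"
  define s u where "s = column_length mu" and "u = column_length lam"
  define nu' where "nu' k = nu ! (k - 1)" for k
  define L R where "L k = Suc (part mu (nu' k))" and "R k = part lam (Suc (nu' k))" for k
  have cell: "(i, j) \<in> skew lam mu \<longleftrightarrow> 1 \<le> j \<and> s j < i \<and> i \<le> u j" for i j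
    using skew_iff[OF lam mu] by (simp add: s_def u_def)
  have n: "j \<le> n \<longleftrightarrow> 1 \<le> u j" if "1 \<le> j" for j
    using part_ge_iff[OF lam, of 1 j] that by (simp add: n_def u_def)
  have col: "\<exists>i. (i, j) \<in> skew lam mu" if "1 \<le> j" "j \<le> n" for j
    using assms(3) that by (auto simp: no_empty_columns_def n_def)
  have nu: "is_partition nu" and ne: "\<And>i. i \<in> set nu \<Longrightarrow> supp lam mu i \<noteq> {}"
    and rep: "\<And>a b. a < b \<Longrightarrow> int (length (sub_inside lam mu nu a b)) \<le> b - a"
    using assms(4) by (auto simp: representable_def admissible_def)
  have nu_mem: "nu' k \<in> set nu" if "1 \<le> k" "k \<le> M" for k
    using that by (auto simp: nu'_def M_def)
  have nu_pos: "1 \<le> nu' k" if "1 \<le> k" "k \<le> M" for k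
    using nu_mem[OF that] nu unfolding is_partition_def by (metis One_nat_def Suc_leI neq0_conv)
  have nu_anti: "nu' k \<le> nu' i" if "1 \<le> i" "i \<le> k" "k \<le> M" for i k
    using that part_antimono[OF nu, of i k] by (auto simp: part_def nu'_def M_def)
  have LR_iff: "L k \<le> j \<and> j \<le> R k \<longleftrightarrow> 1 \<le> j \<and> s j < nu' k \<and> nu' k < u j" if "1 \<le> k" "k \<le> M" for k j
    using part_ge_iff[OF mu, of "nu' k" j] part_ge_iff[OF lam, of "Suc (nu' k)" j] nu_pos[OF that]
    by (cases "1 \<le> j") (auto simp: L_def R_def s_def u_def)
  have supp: "supp lam mu (nu ! (k - 1)) = {int (L k)..int (R k)}" if "1 \<le> k" "k \<le> M" for k
  proof -
    have "{j. (nu' k, j) \<in> skew lam mu \<and> (nu' k + 1, j) \<in> skew lam mu} = {L k..R k}"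
    proof (intro set_eqI)
      fix j show "j \<in> {j. (nu' k, j) \<in> skew lam mu \<and> (nu' k + 1, j) \<in> skew lam mu} \<longleftrightarrow> j \<in> {L k..R k}"
        unfolding mem_Collect_eq cell atLeastAtMost_iff LR_iff[OF that] by linarith
    qed
    then show ?thesis by (simp add: supp_def nu'_def image_int_atLeastAtMost)
  qed
  have LR_le: "L k \<le> R k" if "1 \<le> k" "k \<le> M" for k
    using ne[OF nu_mem[OF that]] supp[OF that] by (simp add: nu'_def)
  interpret F: interval_family lam mu nu n M L R
  proof
    show "part lam 1 = n" "length nu = M" by (simp_all add: n_def M_def)
    show "1 \<le> L k \<and> L k \<le> R k \<and> R k \<le> n" if "1 \<le> k" "k \<le> M" for k
      using LR_le[OF that] part_antimono[OF lam, of 1 "Suc (nu' k)"]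
      by (simp add: L_def R_def n_def)
    show "L i \<le> L k" "R i \<le> R k" if "1 \<le> i" "i \<le> k" "k \<le> M" for i k
      using nu_anti[OF that] nu_pos[of k] that part_antimono[OF mu, of "nu' k" "nu' i"]
        part_antimono[OF lam, of "Suc (nu' k)" "Suc (nu' i)"] by (auto simp: L_def R_def)
  qed (use supp rep in auto)
  interpret C: column_data n M s u nu' L R
  proof
    fix j assume j: "1 \<le> j" "j < n"
    show "s (Suc j) \<le> s j" "u (Suc j) \<le> u j"
      using column_length_antimono[OF mu, of j "Suc j"] column_length_antimono[OF lam, of j "Suc j"] j
      by (auto simp: s_def u_def)
    show "s j < u (Suc j)"
      using connected_cells_overlap[OF lam mu assms(2)] col[of j] col[of "Suc j"] j
      by (auto simp: s_def u_def)
  next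
    show "s j < u j" if "1 \<le> j" "j \<le> n" for j
      using col[OF that] cell by auto
    show "nu' (Suc k) \<le> nu' k" if "1 \<le> k" "k < M" for k
      using nu_anti[of k "Suc k"] that by simp
    show "L k \<le> j \<and> j \<le> R k \<longleftrightarrow> 1 \<le> j \<and> j \<le> n \<and> s j < nu' k \<and> nu' k < u j"
      if "1 \<le> k" "k \<le> M" for k j
      using LR_iff[OF that, of j] n[of j] by auto
  qed (use F.hall in auto)
  let ?N = "F.offset a"
  have cells: "C.cells = skew lam mu"
    using cell n by (auto simp: C.cells_def)
  \<comment> \<open>Descents are only tested at positions \<open>c \<ge> 1\<close>, exactly where
    \<open>cut_iff\<close> identifies cuts with offsets.\<close>
  have "descent_sets {c. C.cut c} (n - M) = descent_sets (?N ` {..<Suc r}) (n - M)"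
    using F.cut_iff[OF assms(5)] unfolding descent_sets_def C.cut_def by blast
  moreover have "n - M = ?N (Suc r)" by (rule F.offset_end[OF assms(5), symmetric])
  ultimately have gf: "(\<Sum>A\<in>descent_sets {c. C.cut c} (n - M). X 1 ^ card A * X 2 ^ (n - M - card A)) =
      (\<Prod>i<Suc r. \<Sum>j=0..?N (Suc i) - ?N i. X 1 ^ (?N (Suc i) - ?N i - j) * X 2 ^ j :: 'k polys)"
    using sum_descent_sets[of ?N "Suc r" "X 1 :: 'k polys" "X 2"] F.offset_0[OF assms(5)]
      F.offset_mono[OF assms(5)] by (simp del: prod.lessThan_Suc)
  also have "\<dots> = (\<Prod>k\<in>{0..r}. P (nat (component_degree lam mu nu a b k)))"
    by (rule prod.cong) (auto simp: P_def F.component_degree_eq[OF assms(5)])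
  finally show ?thesis
    using C.sum_rpp12_descents[of nu "X 1 :: 'k polys" "X 2"]
    by (simp add: RPP12_def x_power_def cells nu'_def M_def)
qed

end
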